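(* Let $\Bbbk$ be a field, $R=\Bbbk[x,y]$, and let $M\subseteq R$ be a monomial ideal with minimal generating set $\{m_1,\dots,m_r\}$, where $m_i=x^{a_i}y^{b_i}$ with $a_1>a_2>\cdots>a_r\ge 0$ and $0\le b_1<b_2<\cdots<b_r$. Assume that $r>2$, or that $r=2$ and $M$ is not generated by pure powers of $x$ and $y$. Let $S=R/M$, and let $F_0,F_1,F_2,F_3$ and $\partial_1,\partial_2,\partial_3$ be the free $S$-modules and maps specified in the context, so that $F_0\cong S$, $F_1\cong S^2$, $F_2\cong S^{r+1}$, $F_3\cong S^{3r-1}$. Then a minimal free resolution of $\Bbbk$ over $S$ is given by $$\mathcal F:\quad S=F_0\xleftarrow{\ \partial_1\ }F_1\xleftarrow{\ \partial_2\ }F_2\xleftarrow{\ \partial_3\ }F_3\xleftarrow{\ \partial_4\ }F_4\longleftarrow\cdots$$ where for $i\ge 3$ the $(i+1)$-st stage is constructed recursively as follows. Given $F_i=F_1^{u_i}\oplus F_2^{v_i}\oplus F_3^{w_i}$ and $\partial_i=\partial_1^{u_i}\oplus\partial_2^{v_i}\oplus\partial_3^{w_i}$, with $u_i,v_i,w_i$ already fixed at the previous stage (starting from $(u_3,v_3,w_3)=(0,0,1)$), the next stage is $$F_i\cong F_1^{u_i}\oplus F_2^{v_i}\oplus F_3^{w_i}\xleftarrow{\ \partial_{i+1}\ }F_1^{(r-1)w_i}\oplus F_2^{u_i+rw_i}\oplus F_3^{v_i}\cong F_{i+1},$$ with $$\partial_{i+1}=\partial_1^{(r-1)w_i}\oplus\partial_2^{u_i+rw_i}\oplus\partial_3^{v_i}$$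 (so $u_{i+1}=(r-1)w_i$, $v_{i+1}=u_i+rw_i$, $w_{i+1}=v_i$), where the target of $\partial_{i+1}$ is identified with $F_0^{(r-1)w_i}\oplus F_1^{u_i+rw_i}\oplus F_2^{v_i}$ through the identification $F_3\cong F_0^{r-1}\oplus F_1^{r}$ described in the context.
   Context: $\Bbbk$ is regarded as the residue field $S/(x,y)S$ of $S$, and the augmentation $S\to\Bbbk$ is the quotient map. A power such as $\partial_j^{n}$ denotes the $n$-fold direct sum of the map $\partial_j$ with itself, and $F_j^n$ the $n$-fold direct sum of the module $F_j$. The free $S$-modules and their bases are: $F_0$ with basis $\{e_1\}$; $F_1$ with basis $\{e_x,e_y\}$; $F_2$ with basis $\{e_{f_1},\dots,e_{f_{r+1}}\}$; $F_3$ with basis $\{e_{c_i^x}\}_{i=1}^r\cup\{e_{c_i^y}\}_{i=1}^r\cup\{e_{d_i}\}_{i=1}^{r-1}$. The $S$-linear maps $\partial_1:F_1\to F_0$, $\partial_2:F_2\to F_1$, $\partial_3:F_3\to F_2$ are given as follows. $\partial_1(e_x)=x\cdot e_1$, $\partial_1(e_y)=y\cdot e_1$. Case 1 ($a_r\ge1$): $\partial_2(e_{f_i})=x^{a_i-1}y^{b_i}e_x$ for $1\le i\le r$, and $\partial_2(e_{f_{r+1}})=-y\,e_x+x\,e_y$. Further, $\partial_3(e_{c_i^x})=x\,e_{f_i}$ for $1\le i\le r$; $\partial_3(e_{c_i^y})=y\,e_{f_i}+x^{a_i-1}y^{b_i}e_{f_{r+1}}$ for $1\le i\le r$; $\partial_3(e_{d_i})=x^{a_i-1}y^{b_{i+1}-1}e_{f_{r+1}}$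 for $1\le i\le r-1$. Case 2 ($a_r=0$, i.e. $m_r=y^{b_r}$): $\partial_2(e_{f_i})=x^{a_i-1}y^{b_i}e_x$ for $1\le i\le r-1$, $\partial_2(e_{f_r})=y^{b_r-1}e_y$, and $\partial_2(e_{f_{r+1}})=-y\,e_x+x\,e_y$. Further, $\partial_3(e_{c_i^x})=x\,e_{f_i}$ for $1\le i\le r-1$ and $\partial_3(e_{c_r^x})=x\,e_{f_r}-y^{b_r-1}e_{f_{r+1}}$; $\partial_3(e_{c_i^y})=y\,e_{f_i}+x^{a_i-1}y^{b_i}e_{f_{r+1}}$ for $1\le i\le r-1$ and $\partial_3(e_{c_r^y})=y\,e_{f_r}$; $\partial_3(e_{d_i})=x^{a_i-1}y^{b_{i+1}-1}e_{f_{r+1}}$ for $1\le i\le r-1$. Identification $F_3\cong F_0^{r-1}\oplus F_1^r$: for $1\le j\le r-1$ the $j$-th copy of $F_0$ is spanned by $e_{d_j}$ (corresponding to $e_1$), and for $1\le j\le r$ the $j$-th copy of $F_1$ is spanned by $e_{c_j^x},e_{c_j^y}$ (corresponding to $e_x,e_y$). *)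

theory Defs
  imports
    "HOL-Algebra.Algebra"
    "HOL-Algebra.Algebraic_Closure_Type"
    "HOL-Library.Poly_Mapping"
    "HOL-Library.Product_Plus"
begin

text \<open>
  The records of HOL-Algebra modules carry the unused ring fields \<open>mult\<close> and \<open>one\<close>, which are left
  unspecified below.
\<close>

definition module_homs ::
  "('s, 'r) ring_scheme \<Rightarrow> ('s, 'u, 'm) module_scheme \<Rightarrow> ('s, 'v, 'n) module_scheme \<Rightarrow> ('u \<Rightarrow> 'v) set"
  where "module_homs S U V =
    {f \<in> carrier U \<rightarrow> carrier V.
       (\<forall>u\<in>carrier U. \<forall>u'\<in>carrier U. f (u \<oplus>\<^bsub>U\<^esub> u') = f u \<oplus>\<^bsub>V\<^esub> f u') \<and>
       (\<forall>s\<in>carrier S. \<forall>u\<in>carrier U. f (s \<odot>\<^bsub>U\<^esub> u) = s \<odot>\<^bsub>V\<^esub> f u)}"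

definition finite_free_module ::
  "('s, 'r) ring_scheme \<Rightarrow> ('s, 'u, 'm) module_scheme \<Rightarrow> bool"
  where "finite_free_module S U \<longleftrightarrow>
    Module.module S U \<and>
    (\<exists>B. finite B \<and> B \<subseteq> carrier U \<and>
      (\<forall>u\<in>carrier U. \<exists>!c. c \<in> B \<rightarrow>\<^sub>E carrier S \<and> u = (\<Oplus>\<^bsub>U\<^esub>e\<in>B. c e \<odot>\<^bsub>U\<^esub> e)))"

definition ideal_smult ::
  "('s, 'r) ring_scheme \<Rightarrow> 's set \<Rightarrow> ('s, 'u, 'm) module_scheme \<Rightarrow> 'u set"
  where "ideal_smult S I U = generate (add_monoid U) {s \<odot>\<^bsub>U\<^esub> u | s u. s \<in> I \<and> u \<in> carrier U}"

definition quotient_module :: "('s, 'r) ring_scheme \<Rightarrow> 's set \<Rightarrow> ('s, 's set) module"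
  where "quotient_module S I =
    \<lparr>carrier = carrier (S Quot I), monoid.mult = undefined, one = undefined,
     ring.zero = \<zero>\<^bsub>S Quot I\<^esub>, add = ring.add (S Quot I),
     module.smult = (\<lambda>s C. (I +>\<^bsub>S\<^esub> s) \<otimes>\<^bsub>S Quot I\<^esub> C)\<rparr>"

text \<open>
  In a resolution \<open>F\<close>, \<open>d\<close> of \<open>N\<close> with augmentation \<open>\<epsilon>\<close>, the map \<open>d i\<close> goes from \<open>F i\<close> to \<open>F (i - 1)\<close>;
  \<open>d 0\<close> is irrelevant.
\<close>

definition free_resolution ::
  "('s, 'r) ring_scheme \<Rightarrow> (nat \<Rightarrow> ('s, 'u, 'm) module_scheme) \<Rightarrow> (nat \<Rightarrow> 'u \<Rightarrow> 'u)
    \<Rightarrow> ('s, 'v, 'n) module_scheme \<Rightarrow> ('u \<Rightarrow> 'v) \<Rightarrow> bool"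
  where "free_resolution S F d N \<epsilon> \<longleftrightarrow>
    cring S \<and> Module.module S N \<and>
    (\<forall>i. finite_free_module S (F i)) \<and>
    \<epsilon> \<in> module_homs S (F 0) N \<and>
    (\<forall>i. d (Suc i) \<in> module_homs S (F (Suc i)) (F i)) \<and>
    \<epsilon> ` carrier (F 0) = carrier N \<and>
    a_kernel (F 0) N \<epsilon> = d 1 ` carrier (F 1) \<and>
    (\<forall>i. a_kernel (F (Suc i)) (F i) (d (Suc i)) = d (Suc (Suc i)) ` carrier (F (Suc (Suc i))))"

text \<open>Minimality is taken with respect to a given ideal \<open>m\<close>, in the application \<open>(x, y)S\<close>.\<close>

definition minimal_free_resolution ::
  "('s, 'r) ring_scheme \<Rightarrow> 's set \<Rightarrow> (nat \<Rightarrow> ('s, 'u, 'm) module_scheme) \<Rightarrow> (nat \<Rightarrow> 'u \<Rightarrow> 'u)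
    \<Rightarrow> ('s, 'v, 'n) module_scheme \<Rightarrow> ('u \<Rightarrow> 'v) \<Rightarrow> bool"
  where "minimal_free_resolution S m F d N \<epsilon> \<longleftrightarrow>
    free_resolution S F d N \<epsilon> \<and>
    (\<forall>i. d (Suc i) ` carrier (F (Suc i)) \<subseteq> ideal_smult S m (F i))"

definition free_mod :: "('s, 'r) ring_scheme \<Rightarrow> 'b set \<Rightarrow> ('s, 'b \<Rightarrow> 's) module"
  where "free_mod S B =
    \<lparr>carrier = B \<rightarrow>\<^sub>E carrier S, monoid.mult = undefined, one = undefined,
     ring.zero = (\<lambda>e\<in>B. \<zero>\<^bsub>S\<^esub>), add = (\<lambda>u v. \<lambda>e\<in>B. u e \<oplus>\<^bsub>S\<^esub> v e),
     module.smult = (\<lambda>s u. \<lambda>e\<in>B. s \<otimes>\<^bsub>S\<^esub> u e)\<rparr>"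

definition basis_vec :: "('s, 'r) ring_scheme \<Rightarrow> 'b set \<Rightarrow> 'b \<Rightarrow> 'b \<Rightarrow> 's"
  where "basis_vec S B e = (\<lambda>e'\<in>B. if e' = e then \<one>\<^bsub>S\<^esub> else \<zero>\<^bsub>S\<^esub>)"

definition linear_extension ::
  "('s, 'r) ring_scheme \<Rightarrow> 'b set \<Rightarrow> ('s, 'v, 'n) module_scheme \<Rightarrow> ('b \<Rightarrow> 'v) \<Rightarrow> ('b \<Rightarrow> 's) \<Rightarrow> 'v"
  where "linear_extension S B V \<phi> =
    (\<lambda>u\<in>carrier (free_mod S B). \<Oplus>\<^bsub>V\<^esub>e\<in>B. u e \<odot>\<^bsub>V\<^esub> \<phi> e)"

text \<open>The ring \<open>k[x, y]\<close> is the monoid algebra of \<open>\<nat> \<times> \<nat>\<close>; \<open>(p, q)\<close> is the exponent vector of \<open>x^p y^q\<close>.\<close>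

type_synonym 'k poly2 = "nat \<times> nat \<Rightarrow>\<^sub>0 'k"

definition kxy :: "('k::field) poly2 ring"
  where "kxy = ring_of_type_algebra"

definition mono2 :: "nat \<Rightarrow> nat \<Rightarrow> ('k::field) poly2"
  where "mono2 p q = Poly_Mapping.single (p, q) 1"

definition minimal_generating_set :: "('a, 'r) ring_scheme \<Rightarrow> 'a set \<Rightarrow> 'a set \<Rightarrow> bool"
  where "minimal_generating_set R I G \<longleftrightarrow>
    G \<subseteq> carrier R \<and> Idl\<^bsub>R\<^esub> G = I \<and> (\<forall>H. H \<subset> G \<longrightarrow> Idl\<^bsub>R\<^esub> H \<noteq> I)"

definition generated_by_pure_powers :: "('k::field) poly2 set \<Rightarrow> bool"
  where "generated_by_pure_powers I \<longleftrightarrow>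
    (\<exists>P \<subseteq> range (\<lambda>n. mono2 n 0) \<union> range (\<lambda>n. mono2 0 n). Idl\<^bsub>kxy\<^esub> P = I)"

definition quot_ring :: "('k::field) poly2 set \<Rightarrow> 'k poly2 set ring"
  where "quot_ring M = kxy Quot M"

definition quot_mono :: "('k::field) poly2 set \<Rightarrow> nat \<Rightarrow> nat \<Rightarrow> 'k poly2 set"
  where "quot_mono M p q = M +>\<^bsub>kxy\<^esub> mono2 p q"

definition xy_ideal :: "('k::field) poly2 set \<Rightarrow> 'k poly2 set set"
  where "xy_ideal M = Idl\<^bsub>quot_ring M\<^esub> {quot_mono M 1 0, quot_mono M 0 1}"

text \<open>
  The sequences \<open>a\<close>, \<open>b\<close> of exponents are indexed from \<open>1\<close> to \<open>r\<close>. In the formulas for the maps, the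
  branch \<open>i = r \<and> a r = 0\<close> is the case where the last generator is a power of \<open>y\<close>. Natural number
  subtraction does not truncate there, as \<open>a i > 0\<close> in the other branches and \<open>b i > 0\<close> for \<open>i > 1\<close>.
\<close>

datatype gen = E_1 | E_x | E_y | E_f nat | E_cx nat | E_cy nat | E_d nat

definition F_basis :: "nat \<Rightarrow> nat \<Rightarrow> gen set"
  where "F_basis r j =
    (if j = 0 then {E_1}
     else if j = 1 then {E_x, E_y}
     else if j = 2 then E_f ` {1..r + 1}
     else if j = 3 then E_cx ` {1..r} \<union> E_cy ` {1..r} \<union> E_d ` {1..r - 1}
     else {})"

definition F_mod :: "('k::field) poly2 set \<Rightarrow> nat \<Rightarrow> nat \<Rightarrow> ('k poly2 set, gen \<Rightarrow> 'k poly2 set) module"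
  where "F_mod M r j = free_mod (quot_ring M) (F_basis r j)"

definition F_vec :: "('k::field) poly2 set \<Rightarrow> nat \<Rightarrow> nat \<Rightarrow> gen \<Rightarrow> gen \<Rightarrow> 'k poly2 set"
  where "F_vec M r j = basis_vec (quot_ring M) (F_basis r j)"

definition bd1_gen :: "('k::field) poly2 set \<Rightarrow> nat \<Rightarrow> gen \<Rightarrow> gen \<Rightarrow> 'k poly2 set"
  where "bd1_gen M r g =
    (let F0 = F_mod M r 0; e = F_vec M r 0; mon = quot_mono M in
     case g of
       E_x \<Rightarrow> mon 1 0 \<odot>\<^bsub>F0\<^esub> e E_1
     | E_y \<Rightarrow> mon 0 1 \<odot>\<^bsub>F0\<^esub> e E_1
     | _ \<Rightarrow> \<zero>\<^bsub>F0\<^esub>)"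

definition bd2_gen ::
  "('k::field) poly2 set \<Rightarrow> nat \<Rightarrow> (nat \<Rightarrow> nat) \<Rightarrow> (nat \<Rightarrow> nat) \<Rightarrow> gen \<Rightarrow> gen \<Rightarrow> 'k poly2 set"
  where "bd2_gen M r a b g =
    (let F1 = F_mod M r 1; e = F_vec M r 1; mon = quot_mono M in
     case g of
       E_f i \<Rightarrow>
         (if i = r + 1 then (\<ominus>\<^bsub>F1\<^esub> (mon 0 1 \<odot>\<^bsub>F1\<^esub> e E_x)) \<oplus>\<^bsub>F1\<^esub> mon 1 0 \<odot>\<^bsub>F1\<^esub> e E_y
          else if i = r \<and> a r = 0 then mon 0 (b r - 1) \<odot>\<^bsub>F1\<^esub> e E_y
          else mon (a i - 1) (b i) \<odot>\<^bsub>F1\<^esub> e E_x)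
     | _ \<Rightarrow> \<zero>\<^bsub>F1\<^esub>)"

definition bd3_gen ::
  "('k::field) poly2 set \<Rightarrow> nat \<Rightarrow> (nat \<Rightarrow> nat) \<Rightarrow> (nat \<Rightarrow> nat) \<Rightarrow> gen \<Rightarrow> gen \<Rightarrow> 'k poly2 set"
  where "bd3_gen M r a b g =
    (let F2 = F_mod M r 2; e = F_vec M r 2; mon = quot_mono M in
     case g of
       E_cx i \<Rightarrow>
         (if i = r \<and> a r = 0
          then mon 1 0 \<odot>\<^bsub>F2\<^esub> e (E_f r) \<ominus>\<^bsub>F2\<^esub> mon 0 (b r - 1) \<odot>\<^bsub>F2\<^esub> e (E_f (r + 1))
          else mon 1 0 \<odot>\<^bsub>F2\<^esub> e (E_f i))
     | E_cy i \<Rightarrow>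
         (if i = r \<and> a r = 0
          then mon 0 1 \<odot>\<^bsub>F2\<^esub> e (E_f r)
          else mon 0 1 \<odot>\<^bsub>F2\<^esub> e (E_f i) \<oplus>\<^bsub>F2\<^esub> mon (a i - 1) (b i) \<odot>\<^bsub>F2\<^esub> e (E_f (r + 1)))
     | E_d i \<Rightarrow> mon (a i - 1) (b (i + 1) - 1) \<odot>\<^bsub>F2\<^esub> e (E_f (r + 1))
     | _ \<Rightarrow> \<zero>\<^bsub>F2\<^esub>)"

text \<open>The map \<open>\<partial>\<^sub>j\<close> from \<open>F\<^sub>j\<close> to \<open>F\<^bsub>j-1\<^esub>\<close>, meaningful for \<open>1 \<le> j \<le> 3\<close>.\<close>

definition bd ::
  "('k::field) poly2 set \<Rightarrow> nat \<Rightarrow> (nat \<Rightarrow> nat) \<Rightarrow> (nat \<Rightarrow> nat) \<Rightarrow> nat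
    \<Rightarrow> (gen \<Rightarrow> 'k poly2 set) \<Rightarrow> (gen \<Rightarrow> 'k poly2 set)"
  where "bd M r a b j =
    linear_extension (quot_ring M) (F_basis r j) (F_mod M r (j - 1))
      (if j = 1 then bd1_gen M r else if j = 2 then bd2_gen M r a b else bd3_gen M r a b)"

text \<open>
  For a list \<open>ns\<close> of multiplicities, \<open>F_sum M r ns\<close> is the direct sum over \<open>j < length ns\<close> of
  \<open>ns ! j\<close> copies of \<open>F\<^sub>j\<close>. The label \<open>(j, l, g)\<close> is the basis element \<open>g\<close> of the copy of \<open>F\<^sub>j\<close>
  with number \<open>l\<close>; copies are numbered from \<open>0\<close>.
\<close>

type_synonym label = "nat \<times> nat \<times> gen"

definition sum_basis :: "nat \<Rightarrow> nat list \<Rightarrow> label set"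
  where "sum_basis r ns = {(j, l, g). j < length ns \<and> l < ns ! j \<and> g \<in> F_basis r j}"

definition F_sum ::
  "('k::field) poly2 set \<Rightarrow> nat \<Rightarrow> nat list \<Rightarrow> ('k poly2 set, label \<Rightarrow> 'k poly2 set) module"
  where "F_sum M r ns = free_mod (quot_ring M) (sum_basis r ns)"

definition sum_component :: "nat \<Rightarrow> nat \<Rightarrow> nat \<Rightarrow> (label \<Rightarrow> 's) \<Rightarrow> gen \<Rightarrow> 's"
  where "sum_component r j l z = (\<lambda>g\<in>F_basis r j. z (j, l, g))"

text \<open>
  The direct sum over \<open>j\<close> of \<open>ns ! j\<close> copies of \<open>\<partial>\<^bsub>j+1\<^esub>\<close>, from \<open>F_sum M r (0 # ns)\<close>
  to \<open>F_sum M r ns\<close>.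
\<close>

definition bd_sum ::
  "('k::field) poly2 set \<Rightarrow> nat \<Rightarrow> (nat \<Rightarrow> nat) \<Rightarrow> (nat \<Rightarrow> nat) \<Rightarrow> nat list
    \<Rightarrow> (label \<Rightarrow> 'k poly2 set) \<Rightarrow> (label \<Rightarrow> 'k poly2 set)"
  where "bd_sum M r a b ns =
    (\<lambda>z\<in>carrier (F_sum M r (0 # ns)).
       \<lambda>(j, l, g)\<in>sum_basis r ns. bd M r a b (Suc j) (sum_component r (Suc j) l z) g)"

text \<open>
  Identification of \<open>F\<^sub>1^u \<oplus> F\<^sub>2^v \<oplus> F\<^sub>3^w\<close> with \<open>F\<^sub>0^((r-1)w) \<oplus> F\<^sub>1^(u+rw) \<oplus> F\<^sub>2^v\<close> on basis labels: each of
  the \<open>w\<close> copies of \<open>F\<^sub>3\<close> becomes \<open>F\<^sub>0^(r-1) \<oplus> F\<^sub>1^r\<close>, and the copies of \<open>F\<^sub>1\<close> so obtained come after the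
  \<open>u\<close> original ones.
\<close>

definition regroup :: "nat \<Rightarrow> nat \<Rightarrow> label \<Rightarrow> label"
  where "regroup r u = (\<lambda>(j, l, g).
    case g of
      E_d i \<Rightarrow> (0, l * (r - 1) + (i - 1), E_1)
    | E_cx i \<Rightarrow> (1, u + (l * r + (i - 1)), E_x)
    | E_cy i \<Rightarrow> (1, u + (l * r + (i - 1)), E_y)
    | _ \<Rightarrow> (j, l, g))"

text \<open>\<open>res_mult r k\<close> is the triple \<open>(u, v, w)\<close> of multiplicities in degree \<open>k + 3\<close>.\<close>

fun res_mult :: "nat \<Rightarrow> nat \<Rightarrow> nat \<times> nat \<times> nat"
  where
    "res_mult r 0 = (0, 0, 1)"
  | "res_mult r (Suc k) = (let (u, v, w) = res_mult r k in ((r - 1) * w, u + r * w, v))"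

definition res_mod ::
  "('k::field) poly2 set \<Rightarrow> nat \<Rightarrow> nat \<Rightarrow> ('k poly2 set, label \<Rightarrow> 'k poly2 set) module"
  where "res_mod M r i =
    (if i = 0 then F_sum M r [1]
     else if i = 1 then F_sum M r [0, 1]
     else if i = 2 then F_sum M r [0, 0, 1]
     else let (u, v, w) = res_mult r (i - 3) in F_sum M r [0, u, v, w])"

definition res_bd ::
  "('k::field) poly2 set \<Rightarrow> nat \<Rightarrow> (nat \<Rightarrow> nat) \<Rightarrow> (nat \<Rightarrow> nat) \<Rightarrow> nat
    \<Rightarrow> (label \<Rightarrow> 'k poly2 set) \<Rightarrow> (label \<Rightarrow> 'k poly2 set)"
  where "res_bd M r a b i =
    (if i \<le> 1 then bd_sum M r a b [1]
     else if i = 2 then bd_sum M r a b [0, 1]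
     else if i = 3 then bd_sum M r a b [0, 0, 1]
     else let (u, v, w) = res_mult r (i - 4) in
       (\<lambda>z\<in>carrier (res_mod M r i).
         \<lambda>t\<in>sum_basis r [0, u, v, w].
           bd_sum M r a b [(r - 1) * w, u + r * w, v] z (regroup r u t)))"

definition residue_field :: "('k::field) poly2 set \<Rightarrow> ('k poly2 set, 'k poly2 set set) module"
  where "residue_field M = quotient_module (quot_ring M) (xy_ideal M)"

definition augmentation :: "('k::field) poly2 set \<Rightarrow> (label \<Rightarrow> 'k poly2 set) \<Rightarrow> 'k poly2 set set"
  where "augmentation M z = xy_ideal M +>\<^bsub>quot_ring M\<^esub> z (0, 0, E_1)"

lemma card_F_basis:
  assumes "r \<ge> 1"
  shows "card (F_basis r 0) = 1" "card (F_basis r 1) = 2"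
    "card (F_basis r 2) = r + 1" "card (F_basis r 3) = 3 * r - 1"
proof -
  have inj: "inj_on E_f A" "inj_on E_cx A" "inj_on E_cy A" "inj_on E_d A" for A
    by (auto simp: inj_on_def)
  show "card (F_basis r 0) = 1" "card (F_basis r 1) = 2" "card (F_basis r 2) = r + 1"
    by (simp_all add: F_basis_def card_image inj)
  have "card (E_cx ` {1..r} \<union> E_cy ` {1..r} \<union> E_d ` {1..r - 1}) = (r + r) + (r - 1)"
    by (subst card_Un_disjoint; (subst card_Un_disjoint)?) (auto simp: card_image inj)
  then show "card (F_basis r 3) = 3 * r - 1"
    using assms by (simp add: F_basis_def)
qed

lemma block_index_inj:
  fixes l l' i i' n :: nat
  assumes "l * n + i = l' * n + i'" "i < n" "i' < n"
  shows "l = l'" "i = i'"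
proof -
  have "(l * n + i) div n = l" "(l' * n + i') div n = l'" using assms(2,3) by auto
  then show "l = l'" using assms(1) by simp
  then show "i = i'" using assms(1) by simp
qed

lemma block_index_surj:
  fixes m n w :: nat
  assumes "m < n * w"
  obtains l i where "m = l * n + i" "i < n" "l < w"
proof
  have n: "n > 0" using assms by (cases n) auto
  show "m = m div n * n + m mod n" by simp
  show "m mod n < n" using n by simp
  show "m div n < w" using assms by (simp add: less_mult_imp_div_less mult.commute)
qed

lemma block_index_less:
  fixes l i n w :: nat
  assumes "l < w" "i < n"
  shows "l * n + i < n * w"
proof -
  have "l * n + i < Suc l * n" using assms by simp
  also have "\<dots> \<le> w * n" using assms by (intro mult_right_mono) auto
  finally show ?thesis by (simp add: mult.commute)
qed

lemma bij_betw_regroup: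
  "bij_betw (regroup r u) (sum_basis r [0, u, v, w]) (sum_basis r [(r - 1) * w, u + r * w, v])"
proof (rule bij_betw_imageI)
  have A: "sum_basis r [0, u, v, w] =
      {1} \<times> {..<u} \<times> {E_x, E_y} \<union> {2} \<times> {..<v} \<times> E_f ` {1..r + 1} \<union>
      {3} \<times> {..<w} \<times> (E_cx ` {1..r} \<union> E_cy ` {1..r} \<union> E_d ` {1..r - 1})" (is "_ = ?A")
    by (auto simp: sum_basis_def F_basis_def less_Suc_eq numeral_eq_Suc)
  have B: "sum_basis r [(r - 1) * w, u + r * w, v] =
      {0} \<times> {..<(r - 1) * w} \<times> {E_1} \<union> {1} \<times> {..<u + r * w} \<times> {E_x, E_y} \<union>
      {2} \<times> {..<v} \<times> E_f ` {1..r + 1}" (is "_ = ?B")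
    by (auto simp: sum_basis_def F_basis_def less_Suc_eq numeral_eq_Suc)
  have inj1: "l = l' \<and> i = i'"
    if eq: "l * n + i - Suc 0 = l' * n + i' - Suc 0"
      and le: "Suc 0 \<le> i" "Suc 0 \<le> i'" "i \<le> n" "i' \<le> n" for l l' i i' n :: nat
  proof -
    have lt: "i - Suc 0 < n" "i' - Suc 0 < n" using le by simp_all
    have "l * n + (i - Suc 0) = l' * n + (i' - Suc 0)" using eq le by simp
    from block_index_inj[OF this lt] show ?thesis using le by linarith
  qed
  have lt1: "l * n + i - Suc 0 < n * w" if "l < w" "Suc 0 \<le> i" "i \<le> n" for l i n :: nat
    using block_index_less[of l w "i - Suc 0" n] that by simp
  have lt2: "u + (l * n + i) - Suc 0 < u + n * w" if "l < w" "Suc 0 \<le> i" "i \<le> n" for l i n :: nat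
    using lt1[OF that] that by linarith
  show "inj_on (regroup r u) (sum_basis r [0, u, v, w])"
    unfolding A by (rule inj_onI) (auto simp: regroup_def dest: inj1)
  show "regroup r u ` sum_basis r [0, u, v, w] = sum_basis r [(r - 1) * w, u + r * w, v]"
    unfolding A B
  proof (intro equalityI subsetI)
    fix t assume "t \<in> regroup r u ` ?A"
    then show "t \<in> ?B"
      by (auto simp: regroup_def intro: lt1 lt2)
  next
    fix t assume "t \<in> ?B"
    then consider m where "t = (0, m, E_1)" "m < (r - 1) * w"
      | m g where "t = (1, m, g)" "m < u" "g \<in> {E_x, E_y}"
      | m g where "t = (1, u + m, g)" "m < r * w" "g \<in> {E_x, E_y}"
      | m i where "t = (2, m, E_f i)" "m < v" "i \<in> {1..r + 1}"
      by (auto, metis le_add_diff_inverse not_le,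
          metis le_add_diff_inverse not_le)
    then show "t \<in> regroup r u ` ?A"
    proof cases
      case (1 m)
      from 1(2) obtain l i where li: "m = l * (r - 1) + i" "i < r - 1" "l < w"
        by (rule block_index_surj)
      then have "t = regroup r u (3, l, E_d (i + 1))" "(3, l, E_d (i + 1)) \<in> ?A"
        using 1 li by (auto simp: regroup_def)
      then show ?thesis by (rule image_eqI)
    next
      case (2 m g)
      then have "t = regroup r u t" "t \<in> ?A" by (auto simp: regroup_def)
      then show ?thesis by (rule image_eqI)
    next
      case (3 m g)
      from 3(2) obtain l i where li: "m = l * r + i" "i < r" "l < w"
        by (rule block_index_surj)
      define h where "h = (if g = E_x then E_cx (i + 1) else E_cy (i + 1))"
      have "t = regroup r u (3, l, h)" "(3, l, h) \<in> ?A"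
        using 3 li by (auto simp: regroup_def h_def)
      then show ?thesis by (rule image_eqI)
    next
      case (4 m i)
      then have "t = regroup r u t" "t \<in> ?A" by (auto simp: regroup_def)
      then show ?thesis by (rule image_eqI)
    qed
  qed
qed

end

theory Submission
  imports Defs
begin

text \<open>
  Write \<open>m\<^sub>i = x \<cdot> ex i + y \<cdot> ey i\<close>, taking \<open>ex i = m\<^sub>i / x\<close> and \<open>ey i = 0\<close> if \<open>x\<close> divides \<open>m\<^sub>i\<close>, and
  \<open>ex i = 0\<close> and \<open>ey i = m\<^sub>i / y\<close> otherwise. Then both cases of the maps are given by
  \<open>\<partial>\<^sub>2 e\<^sub>f\<^sub>i = ex i \<cdot> e\<^sub>x + ey i \<cdot> e\<^sub>y\<close>, \<open>\<partial>\<^sub>3 e\<^sub>c\<^sub>x\<^sub>i = x \<cdot> e\<^sub>f\<^sub>i - ey i \<cdot> e\<close>,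
  \<open>\<partial>\<^sub>3 e\<^sub>c\<^sub>y\<^sub>i = y \<cdot> e\<^sub>f\<^sub>i + ex i \<cdot> e\<close> and \<open>\<partial>\<^sub>3 e\<^sub>d\<^sub>j = w j \<cdot> e\<close>, where \<open>e\<close> is the last basis element of
  \<open>F\<^sub>2\<close>, mapped to \<open>- y \<cdot> e\<^sub>x + x \<cdot> e\<^sub>y\<close>, and the monomials \<open>w j\<close> at the inner corners of the staircase of
  \<open>M\<close> form a basis of the socle of \<open>S\<close>.

  Exactness reduces to three computations with polynomials modulo \<open>M\<close>.

  \<^item> The kernel of \<open>\<partial>\<^sub>1\<close> is the image of \<open>\<partial>\<^sub>2\<close> (\<open>lifted_kernel_1\<close>): if \<open>x p + y q\<close> lies in \<open>M\<close>, it is a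
    combination of the \<open>m\<^sub>i\<close>; subtracting that combination of the pairs \<open>(ex i, ey i)\<close> from \<open>(p, q)\<close>
    leaves a syzygy of \<open>x, y\<close> in \<open>k[x, y]\<close>, hence a multiple of \<open>(- y, x)\<close>.

  \<^item> The kernel of \<open>\<partial>\<^sub>2\<close> is the image of \<open>\<partial>\<^sub>3\<close> (\<open>lifted_kernel_2\<close>): for a kernel element with coefficients
    \<open>s\<^sub>i\<close> and \<open>s'\<close> the combination \<open>\<Sum> s\<^sub>i m\<^sub>i\<close> lies in \<open>(x, y) M\<close>, so all \<open>s\<^sub>i\<close> lie in \<open>(x, y)\<close> as the \<open>m\<^sub>i\<close>
    are minimal generators. The elements \<open>\<partial>\<^sub>3 e\<^sub>c\<^sub>x\<^sub>i\<close> and \<open>\<partial>\<^sub>3 e\<^sub>c\<^sub>y\<^sub>i\<close> then remove the \<open>s\<^sub>i\<close>, and what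
    remains is a multiple of \<open>e\<close> by an element of the socle.

  \<^item> The kernel of \<open>\<partial>\<^sub>3\<close> splits (\<open>lifted_kernel_3\<close>): the coefficients \<open>(p\<^sub>i, q\<^sub>i)\<close> of \<open>e\<^sub>c\<^sub>x\<^sub>i, e\<^sub>c\<^sub>y\<^sub>i\<close> lie in the
    kernel of \<open>\<partial>\<^sub>1\<close>, and then \<open>q\<^sub>i \<cdot> ex i - p\<^sub>i \<cdot> ey i\<close> is in \<open>M\<close> by the first computation, because all
    products \<open>ex i \<cdot> ey j\<close> are in \<open>M\<close>. The exclusion of two pure powers is needed for this, and again for
    minimality. So the coefficients of the \<open>e\<^sub>d\<^sub>j\<close> combine the \<open>w j\<close> to an element of \<open>M\<close>, which happens exactly if they lie in
    the maximal ideal. With \<open>F\<^sub>3 \<cong> F\<^sub>0\<^sup>r\<^sup>-\<^sup>1 \<oplus> F\<^sub>1\<^sup>r\<close> the kernel of \<open>\<partial>\<^sub>3\<close> is therefore the image of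
    \<open>\<partial>\<^sub>1\<^sup>r\<^sup>-\<^sup>1 \<oplus> \<partial>\<^sub>2\<^sup>r\<close>.

  Kernels and images of a direct sum of maps are found copy by copy, and the regrouping of labels is a
  bijection, so the three block statements give exactness in every degree. Minimality holds because every
  matrix entry is a polynomial with constant term \<open>0\<close>.
\<close>

section \<open>Free modules over a commutative ring\<close>

lemma free_mod_simps:
  "carrier (free_mod S B) = B \<rightarrow>\<^sub>E carrier S"
  "\<zero>\<^bsub>free_mod S B\<^esub> = (\<lambda>e\<in>B. \<zero>\<^bsub>S\<^esub>)"
  "u \<oplus>\<^bsub>free_mod S B\<^esub> v = (\<lambda>e\<in>B. u e \<oplus>\<^bsub>S\<^esub> v e)"
  "s \<odot>\<^bsub>free_mod S B\<^esub> u = (\<lambda>e\<in>B. s \<otimes>\<^bsub>S\<^esub> u e)"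
  by (simp_all add: free_mod_def)

lemma module_free_mod:
  assumes "cring S"
  shows "Module.module S (free_mod S B)"
proof -
  interpret S: cring S by fact
  show ?thesis
  proof (rule moduleI[OF assms])
    show "abelian_group (free_mod S B)"
    proof (rule abelian_groupI)
      fix u assume "u \<in> carrier (free_mod S B)"
      then show "\<exists>v\<in>carrier (free_mod S B). v \<oplus>\<^bsub>free_mod S B\<^esub> u = \<zero>\<^bsub>free_mod S B\<^esub>"
        by (intro bexI[of _ "\<lambda>e\<in>B. \<ominus>\<^bsub>S\<^esub> u e"])
          (auto simp: free_mod_simps PiE_iff S.l_neg fun_eq_iff)
    qed (auto simp: free_mod_simps fun_eq_iff PiE_iff extensional_def restrict_def S.a_ac)
  qed (auto simp: free_mod_simps fun_eq_iff PiE_iff extensional_def restrict_def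
      S.l_distr S.r_distr S.m_assoc)
qed

lemma finsum_free_mod:
  assumes "cring S" "finite A" "\<phi> \<in> A \<rightarrow> carrier (free_mod S B)" "g \<in> B"
  shows "(\<Oplus>\<^bsub>free_mod S B\<^esub>e\<in>A. \<phi> e) g = (\<Oplus>\<^bsub>S\<^esub>e\<in>A. \<phi> e g)"
proof -
  interpret S: cring S by fact
  interpret F: module S "free_mod S B" by (rule module_free_mod) fact
  have val: "v g \<in> carrier S" if "v \<in> carrier (free_mod S B)" for v
    using that assms(4) by (auto simp: free_mod_simps)
  show ?thesis
    using assms(2,3)
  proof (induction A)
    case empty
    then show ?case using assms(4) by (simp add: free_mod_simps)
  next
    case (insert e A)
    then have "\<phi> \<in> A \<rightarrow> carrier (free_mod S B)" "\<phi> e \<in> carrier (free_mod S B)" by auto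
    moreover have "(\<lambda>e. \<phi> e g) \<in> A \<rightarrow> carrier S" using calculation val by auto
    ultimately show ?case
      using insert assms(4) val by (simp add: F.finsum_insert S.finsum_insert free_mod_simps(3))
  qed
qed

lemma free_mod_eqI:
  "u \<in> carrier (free_mod S B) \<Longrightarrow> v \<in> carrier (free_mod S B) \<Longrightarrow> (\<And>e. e \<in> B \<Longrightarrow> u e = v e) \<Longrightarrow> u = v"
  by (auto simp: free_mod_simps intro: PiE_ext)

lemma basis_vec_in_carrier: "cring S \<Longrightarrow> basis_vec S B e \<in> carrier (free_mod S B)"
  by (auto simp: basis_vec_def free_mod_simps cring_def ring.ring_simprules)

lemma finsum_basis_vec:
  assumes "cring S" "finite B" "c \<in> B \<rightarrow> carrier S"
  shows "(\<Oplus>\<^bsub>free_mod S B\<^esub>g\<in>B. c g \<odot>\<^bsub>free_mod S B\<^esub> basis_vec S B g) = (\<lambda>g\<in>B. c g)"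
proof -
  interpret S: cring S by fact
  interpret F: module S "free_mod S B" by (rule module_free_mod) fact
  have cl: "(\<lambda>g. c g \<odot>\<^bsub>free_mod S B\<^esub> basis_vec S B g) \<in> B \<rightarrow> carrier (free_mod S B)"
    using assms by (auto intro: basis_vec_in_carrier)
  show ?thesis
  proof (rule free_mod_eqI[of _ S B])
    fix h assume h: "h \<in> B"
    have "(\<Oplus>\<^bsub>free_mod S B\<^esub>g\<in>B. c g \<odot>\<^bsub>free_mod S B\<^esub> basis_vec S B g) h
        = (\<Oplus>\<^bsub>S\<^esub>g\<in>B. (c g \<odot>\<^bsub>free_mod S B\<^esub> basis_vec S B g) h)"
      by (rule finsum_free_mod[OF assms(1,2) cl h])
    also have "\<dots> = (\<Oplus>\<^bsub>S\<^esub>g\<in>B. if h = g then c g else \<zero>\<^bsub>S\<^esub>)"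
      using assms(3) h by (intro S.finsum_cong') (auto simp: free_mod_simps basis_vec_def Pi_iff)
    also have "\<dots> = c h"
      using assms h by (intro S.finsum_singleton) auto
    finally show "(\<Oplus>\<^bsub>free_mod S B\<^esub>g\<in>B. c g \<odot>\<^bsub>free_mod S B\<^esub> basis_vec S B g) h = (\<lambda>g\<in>B. c g) h"
      using h by simp
  qed (use assms F.finsum_closed[OF cl] in \<open>auto simp: free_mod_simps(1)\<close>)
qed

text \<open>
  The hypothesis \<open>\<one> \<noteq> \<zero>\<close> keeps the standard basis vectors distinct, so that families on the set of basis
  vectors correspond to families on \<open>B\<close>.
\<close>

lemma finite_free_module_free_mod:
  assumes "cring S" "finite B" "\<one>\<^bsub>S\<^esub> \<noteq> \<zero>\<^bsub>S\<^esub>"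
  shows "finite_free_module S (free_mod S B)"
proof -
  interpret S: cring S by fact
  interpret F: module S "free_mod S B" by (rule module_free_mod) fact
  let ?bv = "basis_vec S B"
  have inj: "inj_on ?bv B"
    using assms(3) by (auto simp: inj_on_def basis_vec_def fun_eq_iff restrict_def split: if_splits)
  have sum: "(\<Oplus>\<^bsub>free_mod S B\<^esub>e\<in>?bv ` B. c e \<odot>\<^bsub>free_mod S B\<^esub> e) = (\<lambda>g\<in>B. c (?bv g))"
    if c: "c \<in> ?bv ` B \<rightarrow>\<^sub>E carrier S" for c
  proof -
    have "(\<Oplus>\<^bsub>free_mod S B\<^esub>e\<in>?bv ` B. c e \<odot>\<^bsub>free_mod S B\<^esub> e)
        = (\<Oplus>\<^bsub>free_mod S B\<^esub>g\<in>B. c (?bv g) \<odot>\<^bsub>free_mod S B\<^esub> ?bv g)"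
      using c by (intro F.finsum_reindex inj) (auto intro: basis_vec_in_carrier assms(1))
    also have "\<dots> = (\<lambda>g\<in>B. c (?bv g))"
      using c by (intro finsum_basis_vec assms) auto
    finally show ?thesis .
  qed
  have "\<exists>!c. c \<in> ?bv ` B \<rightarrow>\<^sub>E carrier S \<and> u = (\<Oplus>\<^bsub>free_mod S B\<^esub>e\<in>?bv ` B. c e \<odot>\<^bsub>free_mod S B\<^esub> e)"
    if u: "u \<in> carrier (free_mod S B)" for u
  proof -
    define c where "c = (\<lambda>e\<in>?bv ` B. u (inv_into B ?bv e))"
    have c: "c \<in> ?bv ` B \<rightarrow>\<^sub>E carrier S" "\<And>g. g \<in> B \<Longrightarrow> c (?bv g) = u g"
      using u inj by (auto simp: c_def free_mod_simps)
    have "u = (\<Oplus>\<^bsub>free_mod S B\<^esub>e\<in>?bv ` B. c e \<odot>\<^bsub>free_mod S B\<^esub> e)"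
      using u c(2) unfolding sum[OF c(1)] by (auto simp: free_mod_simps fun_eq_iff PiE_iff extensional_def)
    moreover have "c' = c"
      if c': "c' \<in> ?bv ` B \<rightarrow>\<^sub>E carrier S" "u = (\<Oplus>\<^bsub>free_mod S B\<^esub>e\<in>?bv ` B. c' e \<odot>\<^bsub>free_mod S B\<^esub> e)" for c'
    proof (rule PiE_ext[OF c'(1) c(1)])
      fix e assume "e \<in> ?bv ` B"
      then obtain g where g: "g \<in> B" "e = ?bv g" by blast
      have "c' (?bv g) = u g" using g(1) c'(2) unfolding sum[OF c'(1)] by simp
      then show "c' e = c e" using c(2) g by simp
    qed
    ultimately show ?thesis using c(1) by blast
  qed
  moreover have "?bv ` B \<subseteq> carrier (free_mod S B)"
    by (auto intro: basis_vec_in_carrier assms(1))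
  ultimately show ?thesis
    unfolding finite_free_module_def
    using module_free_mod[OF assms(1)] assms(2) by (intro conjI exI[of _ "?bv ` B"]) auto
qed

text \<open>
  Minimality is thereby checked entry by entry: \<open>u\<close> is the sum of its entries times the basis vectors.
\<close>

lemma in_ideal_smult_free_modI:
  assumes "cring S" "ideal I S" "finite B" "u \<in> carrier (free_mod S B)" "\<And>e. e \<in> B \<Longrightarrow> u e \<in> I"
  shows "u \<in> ideal_smult S I (free_mod S B)"
proof -
  interpret S: cring S by fact
  interpret I: ideal I S by fact
  interpret F: module S "free_mod S B" by (rule module_free_mod) fact
  let ?G = "{s \<odot>\<^bsub>free_mod S B\<^esub> v | s v. s \<in> I \<and> v \<in> carrier (free_mod S B)}"
  have "(\<Oplus>\<^bsub>free_mod S B\<^esub>g\<in>A. u g \<odot>\<^bsub>free_mod S B\<^esub> basis_vec S B g) \<in> generate (add_monoid (free_mod S B)) ?G"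
    if "A \<subseteq> B" for A
    using finite_subset[OF that assms(3)] that
  proof (induction A)
    case empty
    then show ?case using generate.one[of "add_monoid (free_mod S B)" ?G] by simp
  next
    case (insert e A)
    have cl: "u g \<odot>\<^bsub>free_mod S B\<^esub> basis_vec S B g \<in> carrier (free_mod S B)" if "g \<in> B" for g
      using assms(5)[OF that] I.Icarr by (intro F.smult_closed basis_vec_in_carrier assms(1)) auto
    have "u e \<in> I" using insert.prems assms(5) by simp
    then have "u e \<odot>\<^bsub>free_mod S B\<^esub> basis_vec S B e \<in> ?G"
      using basis_vec_in_carrier[OF assms(1), of B e] by blast
    then have "u e \<odot>\<^bsub>free_mod S B\<^esub> basis_vec S B e \<in> generate (add_monoid (free_mod S B)) ?G"
      by (rule generate.incl)
    from generate.eng[OF this insert.IH] show ?case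
      using insert cl by (simp add: F.finsum_insert subset_iff Pi_iff)
  qed
  from this[OF order_refl] have "(\<lambda>g\<in>B. u g) \<in> generate (add_monoid (free_mod S B)) ?G"
    using assms(5) by (subst (asm) finsum_basis_vec[OF assms(1,3)]) auto
  moreover have "(\<lambda>g\<in>B. u g) = u" using assms(4) by (auto simp: free_mod_simps PiE_restrict)
  ultimately show ?thesis by (simp add: ideal_smult_def)
qed

lemma linear_extension_in_module_homs:
  assumes "Module.module S V" "finite B" "\<phi> \<in> B \<rightarrow> carrier V"
  shows "linear_extension S B V \<phi> \<in> module_homs S (free_mod S B) V"
proof -
  interpret V: module S V by fact
  have cl: "(\<lambda>e. u e \<odot>\<^bsub>V\<^esub> \<phi> e) \<in> B \<rightarrow> carrier V" if "u \<in> carrier (free_mod S B)" for u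
    using that assms(3) by (auto simp: free_mod_simps)
  show ?thesis
    unfolding module_homs_def
  proof (intro CollectI conjI ballI)
    show "linear_extension S B V \<phi> \<in> carrier (free_mod S B) \<rightarrow> carrier V"
      using cl by (auto simp: linear_extension_def intro!: V.M.finsum_closed)
    interpret F: module S "free_mod S B" by (rule module_free_mod) (rule V.R.cring_axioms)
    fix u v assume u: "u \<in> carrier (free_mod S B)" and v: "v \<in> carrier (free_mod S B)"
    have "linear_extension S B V \<phi> (u \<oplus>\<^bsub>free_mod S B\<^esub> v)
      = (\<Oplus>\<^bsub>V\<^esub>e\<in>B. u e \<odot>\<^bsub>V\<^esub> \<phi> e \<oplus>\<^bsub>V\<^esub> v e \<odot>\<^bsub>V\<^esub> \<phi> e)"
      unfolding linear_extension_def using u v cl[OF u] cl[OF v] assms(3)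
      by (subst restrict_apply', simp, intro V.M.finsum_cong')
        (auto simp: free_mod_simps V.smult_l_distr PiE_iff Pi_iff)
    also have "\<dots> = linear_extension S B V \<phi> u \<oplus>\<^bsub>V\<^esub> linear_extension S B V \<phi> v"
      using u v by (simp add: linear_extension_def V.M.finsum_addf cl)
    finally show "linear_extension S B V \<phi> (u \<oplus>\<^bsub>free_mod S B\<^esub> v)
      = linear_extension S B V \<phi> u \<oplus>\<^bsub>V\<^esub> linear_extension S B V \<phi> v" .
  next
    interpret F: module S "free_mod S B" by (rule module_free_mod) (rule V.R.cring_axioms)
    fix s u assume s: "s \<in> carrier S" and u: "u \<in> carrier (free_mod S B)"
    have "linear_extension S B V \<phi> (s \<odot>\<^bsub>free_mod S B\<^esub> u)
      = (\<Oplus>\<^bsub>V\<^esub>e\<in>B. s \<odot>\<^bsub>V\<^esub> (u e \<odot>\<^bsub>V\<^esub> \<phi> e))"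
      unfolding linear_extension_def using s u cl[OF u] assms(3)
      by (subst restrict_apply', simp, intro V.M.finsum_cong')
        (auto simp: free_mod_simps V.smult_assoc1 PiE_iff Pi_iff)
    also have "\<dots> = s \<odot>\<^bsub>V\<^esub> linear_extension S B V \<phi> u"
      using s u by (simp add: linear_extension_def V.finsum_smult_ldistr assms(2) cl)
    finally show "linear_extension S B V \<phi> (s \<odot>\<^bsub>free_mod S B\<^esub> u) = s \<odot>\<^bsub>V\<^esub> linear_extension S B V \<phi> u" .
  qed
qed

lemma linear_extension_free_mod_apply:
  assumes "cring S" "finite B" "\<phi> \<in> B \<rightarrow> carrier (free_mod S B')"
    "u \<in> carrier (free_mod S B)" "g \<in> B'"
  shows "linear_extension S B (free_mod S B') \<phi> u g = (\<Oplus>\<^bsub>S\<^esub>e\<in>B. u e \<otimes>\<^bsub>S\<^esub> \<phi> e g)"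
proof -
  interpret S: cring S by fact
  interpret F: module S "free_mod S B'" by (rule module_free_mod) fact
  have "linear_extension S B (free_mod S B') \<phi> u g = (\<Oplus>\<^bsub>S\<^esub>e\<in>B. (u e \<odot>\<^bsub>free_mod S B'\<^esub> \<phi> e) g)"
    using assms(3,4) unfolding linear_extension_def
    by (subst restrict_apply', simp, intro finsum_free_mod[OF assms(1,2) _ assms(5)])
      (auto simp: free_mod_simps(1)[of S B])
  also have "\<dots> = (\<Oplus>\<^bsub>S\<^esub>e\<in>B. u e \<otimes>\<^bsub>S\<^esub> \<phi> e g)"
    using assms(3,4,5) by (intro S.finsum_cong') (auto simp: free_mod_simps Pi_iff PiE_iff)
  finally show ?thesis .
qed

lemma module_homs_compI:
  assumes "Module.module S U" "f \<in> module_homs S U V" "g \<in> module_homs S V W"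
    and "\<And>z. z \<in> carrier U \<Longrightarrow> h z = g (f z)"
  shows "h \<in> module_homs S U W"
proof -
  interpret U: module S U by fact
  have f: "f u \<in> carrier V" if "u \<in> carrier U" for u
    using assms(2) that by (auto simp: module_homs_def)
  show ?thesis
    using assms(2,3) by (auto simp: module_homs_def assms(4) f)
qed

lemma module_quotient_module:
  assumes "cring S" "ideal I S"
  shows "Module.module S (quotient_module S I)"
proof -
  interpret S: cring S by fact
  interpret I: ideal I S by fact
  interpret Q: cring "S Quot I" by (rule I.quotient_is_cring) fact
  interpret h: ring_hom_ring S "S Quot I" "(+>\<^bsub>S\<^esub>) I" by (rule I.rcos_ring_hom_ring)
  have sel: "carrier (quotient_module S I) = carrier (S Quot I)"
    "\<zero>\<^bsub>quotient_module S I\<^esub> = \<zero>\<^bsub>S Quot I\<^esub>"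
    "x \<oplus>\<^bsub>quotient_module S I\<^esub> y = x \<oplus>\<^bsub>S Quot I\<^esub> y"
    "s \<odot>\<^bsub>quotient_module S I\<^esub> x = (I +>\<^bsub>S\<^esub> s) \<otimes>\<^bsub>S Quot I\<^esub> x" for x y s
    by (simp_all add: quotient_module_def)
  show ?thesis
  proof (rule moduleI[OF assms(1)])
    show "abelian_group (quotient_module S I)"
    proof (rule abelian_groupI)
      fix x assume "x \<in> carrier (quotient_module S I)"
      then show "\<exists>y\<in>carrier (quotient_module S I). y \<oplus>\<^bsub>quotient_module S I\<^esub> x = \<zero>\<^bsub>quotient_module S I\<^esub>"
        unfolding sel by (intro bexI[of _ "\<ominus>\<^bsub>S Quot I\<^esub> x"]) (auto simp: Q.l_neg)
    qed (auto simp: sel Q.a_ac)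
  qed (auto simp: sel Q.l_distr Q.r_distr Q.m_assoc)
qed

section \<open>Coefficients of polynomials in two variables\<close>

text \<open>
  The coefficient function \<open>lookup\<close> of finitely supported functions, with the type fixed to polynomials
  in two variables. The index \<open>0\<close> is the pair \<open>(0, 0)\<close>, so \<open>coef f 0\<close> is the constant term.
\<close>

abbreviation coef :: "('k::field) poly2 \<Rightarrow> nat \<times> nat \<Rightarrow> 'k"
  where "coef \<equiv> poly_mapping.lookup"

lemma lookup_single_mult:
  fixes f :: "'k::field poly2"
  shows "coef (Poly_Mapping.single (p, q) c * f) (s, t) =
    (if p \<le> s \<and> q \<le> t then c * coef f (s - p, t - q) else 0)"
proof (induction f rule: update_induct)
  case const
  then show ?case by simp
next
  case (update f k v)
  obtain k1 k2 where k: "k = (k1, k2)" by force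
  have "Poly_Mapping.update k v f = Poly_Mapping.single k v + f"
    using update(1) by (intro poly_mapping_eqI)
      (auto simp: lookup_update lookup_add lookup_single when_def in_keys_iff)
  then show ?case
    using update by (auto simp: k lookup_add mult_single lookup_single when_def algebra_simps)
qed

lemma lookup_mono2_mult:
  "coef (mono2 p q * f) (s, t) = (if p \<le> s \<and> q \<le> t then coef f (s - p, t - q) else 0)"
  by (simp add: mono2_def lookup_single_mult)

lemma lookup_mono2: "coef (mono2 p q) k = (if k = (p, q) then 1 else 0)"
  by (simp add: mono2_def lookup_single when_def)

lemma mono2_mult: "mono2 p q * mono2 p' q' = mono2 (p + p') (q + q')"
  by (simp add: mono2_def mult_single)

text \<open>
  Each term of \<open>f\<close> is credited to one generator dividing it. The generation of \<open>M\<close>, of the ideal \<open>(x, y)\<close>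
  and of the socle are all instances.
\<close>

lemma monomial_span:
  fixes f :: "'k::field poly2"
  assumes "finite I"
    and "\<And>s t. coef f (s, t) \<noteq> 0 \<Longrightarrow> \<exists>i\<in>I. \<alpha> i \<le> s \<and> \<beta> i \<le> t"
  shows "\<exists>g. f = (\<Sum>i\<in>I. g i * mono2 (\<alpha> i) (\<beta> i))"
  using assms(2)
proof (induction f rule: update_induct)
  case const
  show ?case by (rule exI[of _ "\<lambda>_. 0"]) simp
next
  case (update f k v)
  obtain k1 k2 where k: "k = (k1, k2)" by force
  have upd: "Poly_Mapping.update k v f = f + Poly_Mapping.single k v"
    using update(1) by (intro poly_mapping_eqI)
      (auto simp: lookup_update lookup_add lookup_single when_def in_keys_iff)
  have "\<exists>i\<in>I. \<alpha> i \<le> s \<and> \<beta> i \<le> t" if "coef f (s, t) \<noteq> 0" for s t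
    using update(4)[of s t] that update(1,2) by (auto simp: lookup_update in_keys_iff split: if_splits)
  from update(3)[OF this] obtain g where g: "f = (\<Sum>i\<in>I. g i * mono2 (\<alpha> i) (\<beta> i))" by blast
  obtain i where i: "i \<in> I" "\<alpha> i \<le> k1" "\<beta> i \<le> k2"
    using update(4)[of k1 k2] update(2) by (auto simp: k lookup_update)
  have "Poly_Mapping.single k v = Poly_Mapping.single (k1 - \<alpha> i, k2 - \<beta> i) v * mono2 (\<alpha> i) (\<beta> i)"
    using i by (simp add: k mono2_def mult_single)
  then have "f + Poly_Mapping.single k v = (\<Sum>j\<in>I. (g j + (if j = i then
      Poly_Mapping.single (k1 - \<alpha> i, k2 - \<beta> i) v else 0)) * mono2 (\<alpha> j) (\<beta> j))"
    using i assms(1) by (simp add: g distrib_right sum.distrib if_distrib[of "\<lambda>x. x * _"] cong: if_cong)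
  then show ?case unfolding upd
    by (rule exI[of _ "\<lambda>j. g j + (if j = i then Poly_Mapping.single (k1 - \<alpha> i, k2 - \<beta> i) v else 0)"])
qed

lemma lookup_0_eq_0_iff:
  fixes f :: "'k::field poly2"
  shows "coef f 0 = 0 \<longleftrightarrow> (\<exists>p q. f = mono2 1 0 * p + mono2 0 1 * q)"
proof
  assume 0: "coef f 0 = 0"
  have "\<exists>i\<in>UNIV. (if i then 1 else 0) \<le> s \<and> (if i then 0 else 1) \<le> t" if "coef f (s, t) \<noteq> 0" for s t
    using that 0 by (cases s; cases t) (auto simp: UNIV_bool zero_prod_def)
  from monomial_span[OF finite this]
  obtain g :: "bool \<Rightarrow> 'k poly2"
    where "f = (\<Sum>i\<in>UNIV. g i * mono2 (if i then 1 else 0) (if i then 0 else 1))" by blast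
  then have "f = mono2 1 0 * g True + mono2 0 1 * g False"
    by (simp add: UNIV_bool algebra_simps)
  then show "\<exists>p q. f = mono2 1 0 * p + mono2 0 1 * q" by blast
next
  assume "\<exists>p q. f = mono2 1 0 * p + mono2 0 1 * q"
  then show "coef f 0 = 0"
    by (auto simp: zero_prod_def lookup_add lookup_mono2_mult)
qed

lemma lookup_0_mult:
  fixes f g :: "'k::field poly2"
  assumes "coef f 0 = 0"
  shows "coef (f * g) 0 = 0"
proof -
  obtain p q where "f = mono2 1 0 * p + mono2 0 1 * q"
    using assms by (auto simp: lookup_0_eq_0_iff)
  then have "f * g = mono2 1 0 * (p * g) + mono2 0 1 * (q * g)"
    by (simp add: algebra_simps)
  then show ?thesis by (auto simp: lookup_0_eq_0_iff)
qed

lemma mono2_mult_eq_0D: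
  assumes "mono2 p q * f = 0"
  shows "f = 0"
proof (rule poly_mapping_eqI)
  fix k :: "nat \<times> nat"
  obtain s t where k: "k = (s, t)" by force
  have "coef (mono2 p q * f) (s + p, t + q) = coef f k"
    by (simp add: lookup_mono2_mult k)
  then show "coef f k = coef 0 k" by (simp add: assms)
qed

text \<open>
  The sequence \<open>x, y\<close> is regular: the coefficients of \<open>q\<close> at pure powers of \<open>y\<close> vanish, so \<open>x\<close> divides
  \<open>q\<close>, and multiplication by \<open>x\<close> is injective.
\<close>

lemma koszul_exact:
  fixes p q :: "'k::field poly2"
  assumes "mono2 1 0 * p + mono2 0 1 * q = 0"
  obtains s where "p = - (mono2 0 1 * s)" "q = mono2 1 0 * s"
proof -
  have "\<exists>i\<in>{()}. 1 \<le> s \<and> 0 \<le> t" if "coef q (s, t) \<noteq> 0" for s t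
  proof (rule ccontr)
    assume "\<not> (\<exists>i\<in>{()}. 1 \<le> s \<and> 0 \<le> t)"
    then have "s = 0" by simp
    with that arg_cong[OF assms, of "\<lambda>f. coef f (s, t + 1)"] show False
      by (simp add: lookup_add lookup_mono2_mult)
  qed
  from monomial_span[where \<alpha> = "\<lambda>_. 1" and \<beta> = "\<lambda>_. 0", OF _ this]
  obtain s where s: "q = mono2 1 0 * s" by (auto simp: mult.commute)
  have "mono2 1 0 * (p + mono2 0 1 * s) = 0"
    using assms by (simp add: s algebra_simps)
  then have "p + mono2 0 1 * s = 0" by (rule mono2_mult_eq_0D)
  then show thesis using s that by (simp add: add_eq_0_iff2)
qed

lemma ideal_kxyI:
  fixes I :: "('k::field) poly2 set"
  assumes "0 \<in> I" "\<And>f g. f \<in> I \<Longrightarrow> g \<in> I \<Longrightarrow> f + g \<in> I" "\<And>f g. f \<in> I \<Longrightarrow> g * f \<in> I"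
  shows "ideal I kxy"
proof -
  interpret R: cring "kxy :: 'k poly2 ring" unfolding kxy_def by (rule cring_from_type_algebra)
  have neg: "- f \<in> I" if "f \<in> I" for f using assms(3)[OF that, of "-1"] by simp
  have inv: "\<ominus>\<^bsub>kxy\<^esub> f = - f" for f :: "'k poly2"
    by (rule R.minus_equality) (simp_all add: kxy_def ring_of_type_algebra_def)
  have "subgroup I (add_monoid (kxy :: 'k poly2 ring))"
  proof (rule R.add.subgroupI)
    show "\<ominus>\<^bsub>kxy\<^esub> f \<in> I" if "f \<in> I" for f
      using neg[OF that] by (simp add: inv)
  qed (use assms in \<open>auto simp: kxy_def ring_of_type_algebra_def\<close>)
  then show ?thesis
    by (intro idealI R.ring_axioms)
      (use assms in \<open>auto simp: kxy_def ring_of_type_algebra_def mult.commute\<close>)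
qed

section \<open>Index sets of direct sums\<close>

lemma sum_basis_iff: "(j, l, g) \<in> sum_basis r ns \<longleftrightarrow> j < length ns \<and> l < ns ! j \<and> g \<in> F_basis r j"
  by (simp add: sum_basis_def)

lemma finite_sum_basis: "finite (sum_basis r ns)"
proof -
  have "sum_basis r ns = (SIGMA j:{..<length ns}. {..<ns ! j} \<times> F_basis r j)"
    by (auto simp: sum_basis_def)
  then show ?thesis by (simp add: F_basis_def)
qed

text \<open>
  Numbers below \<open>n * w\<close> are \<open>w\<close> blocks of length \<open>n\<close>; the position within a block is counted from \<open>1\<close>, as
  the indices of the generators are.
\<close>

lemma all_less_mult_iff:
  fixes n w :: nat
  shows "(\<forall>m < n * w. P m) \<longleftrightarrow> (\<forall>l < w. \<forall>i\<in>{1..n}. P (l * n + (i - 1)))"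
proof
  assume P: "\<forall>m < n * w. P m"
  show "\<forall>l < w. \<forall>i\<in>{1..n}. P (l * n + (i - 1))"
  proof (intro allI impI ballI)
    fix l i assume "l < w" "i \<in> {1..n}"
    then show "P (l * n + (i - 1))" using P block_index_less[of l w "i - 1" n] by auto
  qed
next
  assume P: "\<forall>l < w. \<forall>i\<in>{1..n}. P (l * n + (i - 1))"
  show "\<forall>m < n * w. P m"
  proof (intro allI impI)
    fix m assume "m < n * w"
    then obtain l i where li: "m = l * n + i" "i < n" "l < w" by (rule block_index_surj)
    then have "P (l * n + (Suc i - 1))" by (intro P[rule_format]) auto
    then show "P m" using li by simp
  qed
qed

lemma all_less_add_iff:
  fixes m n :: nat
  shows "(\<forall>k < m + n. P k) \<longleftrightarrow> (\<forall>k < m. P k) \<and> (\<forall>k < n. P (m + k))"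
proof -
  have "P k" if "\<forall>k < m. P k" "\<forall>k < n. P (m + k)" "k < m + n" for k
  proof (cases "k < m")
    case False
    then have "P (m + (k - m))" using that by (intro that(2)[rule_format]) auto
    then show ?thesis using False by simp
  qed (use that in simp)
  then show ?thesis by (auto simp: trans_less_add1)
qed

lemma all_less_lengths_3:
  "(\<forall>j < length [n0, n1, n2]. \<forall>l < [n0, n1, n2] ! j. P j l) \<longleftrightarrow>
    (\<forall>l < n0. P 0 l) \<and> (\<forall>l < n1. P 1 l) \<and> (\<forall>l < n2. P 2 l)"
  by (auto simp: All_less_Suc numeral_2_eq_2)

section \<open>The monomial ideal of a staircase\<close>

text \<open>
  The generators \<open>x^(a i) y^(b i)\<close> form a descending staircase, which makes them minimal. The assumption
  \<open>not_pure\<close> says that \<open>M\<close> is not generated by one power of \<open>x\<close> and one power of \<open>y\<close>.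
\<close>

locale staircase =
  fixes M :: "'k::field poly2 set" and r :: nat and a b :: "nat \<Rightarrow> nat"
  assumes M_eq_Idl: "M = Idl\<^bsub>kxy\<^esub> ((\<lambda>i. mono2 (a i) (b i)) ` {1..r})"
    and a_dec: "\<And>i j. 1 \<le> i \<Longrightarrow> i < j \<Longrightarrow> j \<le> r \<Longrightarrow> a j < a i"
    and b_inc: "\<And>i j. 1 \<le> i \<Longrightarrow> i < j \<Longrightarrow> j \<le> r \<Longrightarrow> b i < b j"
    and r_ge_2: "r \<ge> 2"
    and not_pure: "\<not> (r = 2 \<and> a 2 = 0 \<and> b 1 = 0)"
begin

text \<open>
  Exponent vectors of the monomials in \<open>M\<close>.
\<close>

definition \<Delta> :: "(nat \<times> nat) set"
  where "\<Delta> = {(p, q). \<exists>i\<in>{1..r}. a i \<le> p \<and> b i \<le> q}"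

lemma \<Delta>_iff: "(p, q) \<in> \<Delta> \<longleftrightarrow> (\<exists>i\<in>{1..r}. a i \<le> p \<and> b i \<le> q)"
  by (simp add: \<Delta>_def)

text \<open>
  Together with \<open>ey\<close>: a fixed expression of each generator as \<open>x \<cdot> ex i + y \<cdot> ey i\<close>. Only a generator that
  is a power of \<open>y\<close> has a nonzero \<open>ey\<close>. The maps \<open>\<partial>\<^sub>2\<close> and \<open>\<partial>\<^sub>3\<close> have one formula in terms of \<open>ex\<close> and \<open>ey\<close>,
  whether or not there is such a generator.
\<close>

definition ex :: "nat \<Rightarrow> 'k poly2"
  where "ex i = (if a i > 0 then mono2 (a i - 1) (b i) else 0)"

definition ey :: "nat \<Rightarrow> 'k poly2"
  where "ey i = (if a i > 0 then 0 else mono2 0 (b i - 1))"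

text \<open>
  The monomials at the inner corners of the staircase: they are not in \<open>M\<close>, but become so after
  multiplication by \<open>x\<close> or \<open>y\<close>.
\<close>

definition w :: "nat \<Rightarrow> 'k poly2"
  where "w j = mono2 (a j - 1) (b (j + 1) - 1)"

lemma a_le_iff: "i \<in> {1..r} \<Longrightarrow> j \<in> {1..r} \<Longrightarrow> a i \<le> a j \<longleftrightarrow> j \<le> i"
  by (metis a_dec atLeastAtMost_iff le_less_linear less_le_not_le nat_le_linear order_le_less)

lemma b_le_iff: "i \<in> {1..r} \<Longrightarrow> j \<in> {1..r} \<Longrightarrow> b i \<le> b j \<longleftrightarrow> i \<le> j"
  by (metis b_inc atLeastAtMost_iff le_less_linear less_le_not_le nat_le_linear order_le_less)

lemma a_pos: "1 \<le> i \<Longrightarrow> i < r \<Longrightarrow> 0 < a i"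
  using a_dec[of i r] by simp

lemma b_pos: "1 < i \<Longrightarrow> i \<le> r \<Longrightarrow> 0 < b i"
  using b_inc[of 1 i] by simp

lemma a_eq_0D: "i \<in> {1..r} \<Longrightarrow> a i = 0 \<Longrightarrow> i = r"
  using a_pos[of i] by force

lemma b_eq_0D: "i \<in> {1..r} \<Longrightarrow> b i = 0 \<Longrightarrow> i = 1"
  using b_pos[of i] by force

lemma generator_split:
  assumes "i \<in> {1..r}"
  shows "mono2 (a i) (b i) = mono2 1 0 * ex i + mono2 0 1 * ey i"
proof (cases "a i > 0")
  case False
  then have "b i > 0" using a_eq_0D[OF assms] b_pos[of i] r_ge_2 by simp
  with False show ?thesis by (simp add: ex_def ey_def mono2_mult)
qed (simp add: ex_def ey_def mono2_mult)

lemma ideal_\<Delta>: "ideal {f :: 'k poly2. \<forall>k. k \<notin> \<Delta> \<longrightarrow> coef f k = 0} kxy"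
proof (rule ideal_kxyI)
  fix f g :: "'k poly2"
  assume f: "f \<in> {f. \<forall>k. k \<notin> \<Delta> \<longrightarrow> coef f k = 0}"
  have up: "(s + p, t + q) \<in> \<Delta>" if "(s, t) \<in> \<Delta>" for s t p q
    using that by (force simp: \<Delta>_iff)
  have "Poly_Mapping.keys (g * f) \<subseteq> \<Delta>"
  proof -
    have "Poly_Mapping.keys f \<subseteq> \<Delta>"
    proof
      fix k assume "k \<in> Poly_Mapping.keys f"
      then have "coef f k \<noteq> 0" by (simp add: in_keys_iff)
      then show "k \<in> \<Delta>" using f by blast
    qed
    then show ?thesis using keys_mult[of g f] up by (fastforce simp: add.commute)
  qed
  then show "g * f \<in> {f. \<forall>k. k \<notin> \<Delta> \<longrightarrow> coef f k = 0}"
    by (auto simp: in_keys_iff)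
qed (auto simp: lookup_add)

text \<open>
  Membership in a monomial ideal can be read off from the monomials that occur. All later membership
  proofs use this description.
\<close>

lemma in_M_iff: "f \<in> M \<longleftrightarrow> (\<forall>k. k \<notin> \<Delta> \<longrightarrow> coef f k = 0)"
proof
  interpret R: cring "kxy :: 'k poly2 ring" unfolding kxy_def by (rule cring_from_type_algebra)
  have "M \<subseteq> {f :: 'k poly2. \<forall>k. k \<notin> \<Delta> \<longrightarrow> coef f k = 0}"
    unfolding M_eq_Idl
    by (rule R.genideal_minimal[OF ideal_\<Delta>]) (auto simp: lookup_mono2 \<Delta>_iff)
  then show "f \<in> M \<Longrightarrow> \<forall>k. k \<notin> \<Delta> \<longrightarrow> coef f k = 0" by blast
  assume f: "\<forall>k. k \<notin> \<Delta> \<longrightarrow> coef f k = 0"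
  have "\<exists>i\<in>{1..r}. a i \<le> s \<and> b i \<le> t" if "coef f (s, t) \<noteq> 0" for s t
    using f that \<Delta>_iff by blast
  from monomial_span[OF _ this] obtain g where g: "f = (\<Sum>i\<in>{1..r}. g i * mono2 (a i) (b i))"
    by auto
  have M: "ideal M kxy"
    unfolding M_eq_Idl by (rule R.genideal_ideal) (simp add: kxy_def ring_of_type_algebra_def)
  have gens: "mono2 (a i) (b i) \<in> M" if "i \<in> {1..r}" for i
    unfolding M_eq_Idl using R.genideal_self[of "(\<lambda>i. mono2 (a i) (b i)) ` {1..r}"] that
    by (auto simp: kxy_def ring_of_type_algebra_def)
  have add: "f + g \<in> M" if "f \<in> M" "g \<in> M" for f g
    using additive_subgroup.a_closed[OF ideal.axioms(1)[OF M] that]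
    by (simp add: kxy_def ring_of_type_algebra_def)
  have 0: "0 \<in> M"
    using additive_subgroup.zero_closed[OF ideal.axioms(1)[OF M]]
    by (simp add: kxy_def ring_of_type_algebra_def)
  have mult: "g * f \<in> M" if "f \<in> M" for f g
    using ideal.I_l_closed[OF M that, of g] by (simp add: kxy_def ring_of_type_algebra_def)
  have "(\<Sum>i\<in>J. g i * mono2 (a i) (b i)) \<in> M" if "J \<subseteq> {1..r}" for J
    using finite_subset[OF that finite_atLeastAtMost] that
    by (induction J rule: finite_induct) (auto intro!: 0 add mult gens)
  then show "f \<in> M" unfolding g by blast
qed

lemma ideal_M: "ideal M kxy"
proof -
  have "M = {f. \<forall>k. k \<notin> \<Delta> \<longrightarrow> coef f k = 0}" using in_M_iff by blast
  then show ?thesis using ideal_\<Delta> by metis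
qed

lemma M_0 [simp]: "0 \<in> M"
  by (simp add: in_M_iff)

lemma M_add: "f \<in> M \<Longrightarrow> g \<in> M \<Longrightarrow> f + g \<in> M"
  by (simp add: in_M_iff lookup_add)

lemma M_diff: "f \<in> M \<Longrightarrow> g \<in> M \<Longrightarrow> f - g \<in> M"
  by (simp add: in_M_iff lookup_minus)

lemma M_mult: "f \<in> M \<Longrightarrow> g * f \<in> M"
  using ideal.I_l_closed[OF ideal_M, of f g] by (simp add: kxy_def ring_of_type_algebra_def)

lemma M_mult': "f \<in> M \<Longrightarrow> f * g \<in> M"
  using M_mult[of f g] by (simp add: mult.commute)

lemma M_sum: "(\<And>i. i \<in> I \<Longrightarrow> f i \<in> M) \<Longrightarrow> sum f I \<in> M"
  by (induction I rule: infinite_finite_induct) (auto intro: M_add)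

lemma mono2_in_M_iff: "mono2 p q \<in> M \<longleftrightarrow> (p, q) \<in> \<Delta>"
  by (auto simp: in_M_iff lookup_mono2)

lemma generator_in_M: "i \<in> {1..r} \<Longrightarrow> mono2 1 0 * ex i + mono2 0 1 * ey i \<in> M"
  unfolding generator_split[symmetric] by (auto simp: mono2_in_M_iff \<Delta>_iff)

lemma M_span:
  assumes "f \<in> M"
  obtains g where "f = (\<Sum>i\<in>{1..r}. g i * (mono2 1 0 * ex i + mono2 0 1 * ey i))"
proof -
  have "\<exists>i\<in>{1..r}. a i \<le> s \<and> b i \<le> t" if "coef f (s, t) \<noteq> 0" for s t
    using assms that in_M_iff \<Delta>_iff by blast
  from monomial_span[OF _ this] obtain g where g: "f = (\<Sum>i\<in>{1..r}. g i * mono2 (a i) (b i))"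
    by auto
  also have "\<dots> = (\<Sum>i\<in>{1..r}. g i * (mono2 1 0 * ex i + mono2 0 1 * ey i))"
    by (rule sum.cong) (simp_all add: generator_split del: One_nat_def)
  finally show thesis by (rule that)
qed

text \<open>
  The coefficient of \<open>\<Sum> s j m\<^sub>j\<close> at the exponent of \<open>m\<^sub>i\<close> is the constant term of \<open>s i\<close>, since no other
  generator divides \<open>m\<^sub>i\<close>. On the right-hand side it vanishes, as \<open>m\<^sub>i / x\<close> and \<open>m\<^sub>i / y\<close>
  are not in \<open>M\<close>.
\<close>

lemma generators_minimal:
  assumes eq: "(\<Sum>i\<in>{1..r}. s i * (mono2 1 0 * ex i + mono2 0 1 * ey i))
      = mono2 1 0 * u + mono2 0 1 * v"
    and uv: "u \<in> M" "v \<in> M" and i: "i \<in> {1..r}"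
  shows "coef (s i) 0 = 0"
proof -
  have "coef (mono2 (a j) (b j) * s j) (a i, b i) = (if j = i then coef (s i) 0 else 0)"
    if "j \<in> {1..r}" for j
    using that i a_le_iff[OF that i] b_le_iff[OF that i]
    by (auto simp: lookup_mono2_mult zero_prod_def)
  then have "coef (\<Sum>j\<in>{1..r}. mono2 (a j) (b j) * s j) (a i, b i) = coef (s i) 0"
    using i by (simp add: lookup_sum)
  moreover have "(\<Sum>j\<in>{1..r}. mono2 (a j) (b j) * s j) = mono2 1 0 * u + mono2 0 1 * v"
    unfolding eq[symmetric] by (rule sum.cong) (simp_all add: generator_split mult.commute del: One_nat_def)
  moreover have "coef (mono2 1 0 * u + mono2 0 1 * v) (a i, b i) = 0"
  proof -
    have "a i > 0 \<Longrightarrow> (a i - 1, b i) \<notin> \<Delta>" "b i > 0 \<Longrightarrow> (a i, b i - 1) \<notin> \<Delta>"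
    proof -
      show "(a i - 1, b i) \<notin> \<Delta>" if "a i > 0"
      proof
        assume "(a i - 1, b i) \<in> \<Delta>"
        then obtain j where j: "j \<in> {1..r}" "a j \<le> a i - 1" "b j \<le> b i" by (auto simp: \<Delta>_iff)
        then show False using a_le_iff[of j i] b_le_iff[of j i] i that by auto
      qed
      show "(a i, b i - 1) \<notin> \<Delta>" if "b i > 0"
      proof
        assume "(a i, b i - 1) \<in> \<Delta>"
        then obtain j where j: "j \<in> {1..r}" "a j \<le> a i" "b j \<le> b i - 1" by (auto simp: \<Delta>_iff)
        then show False using a_le_iff[of j i] b_le_iff[of j i] i that by auto
      qed
    qed
    then show ?thesis using uv by (auto simp: lookup_add lookup_mono2_mult in_M_iff)
  qed
  ultimately show ?thesis by simp
qed

lemma w_killed: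
  assumes "j \<in> {1..r - 1}"
  shows "mono2 1 0 * w j \<in> M" "mono2 0 1 * w j \<in> M"
proof -
  have a: "a j > 0" and b: "b (j + 1) > 0" using a_pos[of j] b_pos[of "j + 1"] assms by auto
  have "b j \<le> b (j + 1) - 1" using b_inc[of j "j + 1"] assms by fastforce
  then show "mono2 1 0 * w j \<in> M"
    using a assms by (auto simp: w_def mono2_mult mono2_in_M_iff \<Delta>_iff intro!: bexI[of _ j])
  have "a (j + 1) \<le> a j - 1" using a_dec[of j "j + 1"] assms by fastforce
  then show "mono2 0 1 * w j \<in> M"
    using b assms by (auto simp: w_def mono2_mult mono2_in_M_iff \<Delta>_iff intro!: bexI[of _ "j + 1"])
qed

text \<open>
  A monomial outside \<open>M\<close> that both \<open>x\<close> and \<open>y\<close> move into \<open>M\<close> sits at an inner corner: the generator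
  that captures it after multiplication by \<open>x\<close> and the one after multiplication by \<open>y\<close> are neighbours.
\<close>

lemma socle_span:
  assumes "mono2 1 0 * s \<in> M" "mono2 0 1 * s \<in> M"
  obtains t where "s - (\<Sum>j\<in>{1..r - 1}. t j * w j) \<in> M"
proof -
  (* s2 keeps exactly the terms of s outside M. *)
  define s2 where "s2 = Poly_Mapping.mapp (\<lambda>k c. if k \<in> \<Delta> then 0 else c) s"
  have s2: "coef s2 k = (if k \<in> \<Delta> then 0 else coef s k)" for k
    by (auto simp: s2_def lookup_mapp in_keys_iff when_def)
  have diff: "s - s2 \<in> M" by (auto simp: in_M_iff lookup_minus s2)
  have "\<exists>j\<in>{1..r - 1}. a j - 1 \<le> p \<and> b (j + 1) - 1 \<le> q" if nz: "coef s2 (p, q) \<noteq> 0" for p q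
  proof -
    have pq: "(p, q) \<notin> \<Delta>" and c: "coef s (p, q) \<noteq> 0" using nz by (auto simp: s2 split: if_splits)
    have "(p + 1, q) \<in> \<Delta>"
      using assms(1) c unfolding in_M_iff by (force simp: lookup_mono2_mult)
    then obtain i where i: "i \<in> {1..r}" "a i \<le> p + 1" "b i \<le> q" by (auto simp: \<Delta>_iff)
    have ai: "a i = p + 1" using pq i by (auto simp: \<Delta>_iff le_Suc_eq)
    have "(p, q + 1) \<in> \<Delta>"
      using assms(2) c unfolding in_M_iff by (force simp: lookup_mono2_mult)
    then obtain j where j: "j \<in> {1..r}" "a j \<le> p" "b j \<le> q + 1" by (auto simp: \<Delta>_iff)
    have "i < j" using a_le_iff[of i j] i j ai by (metis Suc_eq_plus1 le_trans not_less not_less_eq_eq order_refl)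
    then have "i \<in> {1..r - 1}" "b (i + 1) \<le> b j" using i j b_le_iff[of "i + 1" j] by auto
    then show ?thesis using ai j(3) by (intro bexI[of _ i]) auto
  qed
  from monomial_span[OF _ this] obtain t where "s2 = (\<Sum>j\<in>{1..r - 1}. t j * w j)"
    by (auto simp: w_def)
  with diff show thesis by (auto intro: that)
qed

text \<open>
  The corner monomials are pairwise indivisible and not in \<open>M\<close>, so the coefficient of the sum at the \<open>i\<close>-th
  corner is the constant term of \<open>t i\<close>.
\<close>

lemma socle_minimal:
  assumes t: "(\<Sum>j\<in>{1..r - 1}. t j * w j) \<in> M" and i: "i \<in> {1..r - 1}"
  shows "coef (t i) 0 = 0"
proof -
  have "(a i - 1, b (i + 1) - 1) \<notin> \<Delta>"
  proof
    assume "(a i - 1, b (i + 1) - 1) \<in> \<Delta>"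
    then obtain j where j: "j \<in> {1..r}" "a j \<le> a i - 1" "b j \<le> b (i + 1) - 1" by (auto simp: \<Delta>_iff)
    have "\<not> j \<le> i"
    proof
      assume "j \<le> i"
      then have "a i \<le> a j" using a_le_iff[of i j] j i by auto
      moreover have "a i > 0" using a_pos[of i] i r_ge_2 by auto
      ultimately show False using j by simp
    qed
    moreover have "j < i + 1" using b_le_iff[of "i + 1" j] j i b_pos[of "i + 1"] by force
    ultimately show False by simp
  qed
  then have "coef (\<Sum>j\<in>{1..r - 1}. w j * t j) (a i - 1, b (i + 1) - 1) = 0"
    using t by (auto simp: in_M_iff mult.commute)
  moreover have "coef (w j * t j) (a i - 1, b (i + 1) - 1) = (if j = i then coef (t i) 0 else 0)"
    if j: "j \<in> {1..r - 1}" for j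
  proof -
    have ir: "i \<in> {1..r}" "i < r" "j \<in> {1..r}" "j < r" using i j r_ge_2 by auto
    have "a j - 1 \<le> a i - 1 \<longleftrightarrow> i \<le> j"
      using a_le_iff[of j i] a_pos[of i] a_pos[of j] ir by auto
    moreover have "b (j + 1) - 1 \<le> b (i + 1) - 1 \<longleftrightarrow> j \<le> i"
      using b_le_iff[of "j + 1" "i + 1"] b_pos[of "i + 1"] b_pos[of "j + 1"] ir by auto
    ultimately show ?thesis
      by (auto simp: w_def lookup_mono2_mult zero_prod_def)
  qed
  ultimately show ?thesis using i by (simp add: lookup_sum)
qed

text \<open>
  The product is nonzero only if \<open>m\<^sub>j\<close> is the power \<open>y^(b r)\<close>. If \<open>y\<close> divides \<open>m\<^sub>i\<close>, the product is a
  multiple of \<open>m\<^sub>r\<close>. Otherwise \<open>i = 1\<close> and the product is \<open>x^(a 1 - 1) y^(b r - 1)\<close>, a multiple of \<open>m\<^sub>2\<close>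
  provided that \<open>r > 2\<close>; for two pure powers it is a nonzero socle element of the quotient.
\<close>

lemma ex_ey_in_M:
  assumes i: "i \<in> {1..r}" and j: "j \<in> {1..r}"
  shows "ex i * ey j \<in> M"
proof (cases "a i > 0 \<and> a j = 0")
  case True
  then have jr: "j = r" using a_eq_0D j by simp
  have br: "b r > 0" using b_pos[of r] r_ge_2 by simp
  have "(a i - 1, b i + (b r - 1)) \<in> \<Delta>"
  proof (cases "b i > 0")
    case True
    then show ?thesis using \<open>a i > 0 \<and> a j = 0\<close> j jr by (auto simp: \<Delta>_iff intro!: bexI[of _ r])
  next
    case False
    then have "i = 1" using b_eq_0D i by simp
    then have "r > 2" using not_pure True jr False r_ge_2 by (cases "r = 2") auto
    then show ?thesis using \<open>i = 1\<close> a_dec[of 1 2] b_inc[of 2 r] by (auto simp: \<Delta>_iff intro!: bexI[of _ 2])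
  qed
  then show ?thesis using True jr by (simp add: ex_def ey_def mono2_mult mono2_in_M_iff)
qed (auto simp: ex_def ey_def)

text \<open>
  A constant entry would need a generator equal to \<open>x\<close> or \<open>y\<close>, or an inner corner at the origin. Both
  force \<open>r = 2\<close> and two pure powers.
\<close>

lemma coef_0_entries:
  "i \<in> {1..r} \<Longrightarrow> coef (ex i) 0 = 0" "i \<in> {1..r} \<Longrightarrow> coef (ey i) 0 = 0"
  "j \<in> {1..r - 1} \<Longrightarrow> coef (w j) 0 = 0"
proof -
  have key: False if ij: "1 \<le> i" "i < j" "j \<le> r" and "a i \<le> 1" "b j \<le> 1" for i j
  proof -
    have "a j = 0" "b i = 0" using a_dec[OF ij] b_inc[OF ij] that by auto
    then have "i = 1" "j = r" using ij a_eq_0D b_eq_0D by auto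
    moreover have "r = 2"
    proof (rule ccontr)
      assume "r \<noteq> 2"
      then have "1 < (2::nat)" "2 < r" using r_ge_2 by auto
      then show False using a_dec[of 1 2] a_pos[of 2] \<open>i = 1\<close> that by auto
    qed
    ultimately show False using not_pure \<open>a j = 0\<close> \<open>b i = 0\<close> by auto
  qed
  show "coef (w j) 0 = 0" if j: "j \<in> {1..r - 1}"
  proof -
    have "1 \<le> j" "j < j + 1" "j + 1 \<le> r" using j r_ge_2 by auto
    from key[OF this] show ?thesis by (auto simp: w_def lookup_mono2 zero_prod_def)
  qed
  show "coef (ey i) 0 = 0" if i: "i \<in> {1..r}"
  proof (cases "a i = 0 \<and> b i \<le> 1")
    case True
    then have "i = r" using a_eq_0D i by simp
    have "r = 2"
    proof (rule ccontr)
      assume "r \<noteq> 2"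
      then have "b 1 < b 2" "b 2 < b r" using r_ge_2 by (auto intro: b_inc)
      then show False using True \<open>i = r\<close> by simp
    qed
    then show ?thesis using not_pure True \<open>i = r\<close> b_inc[of 1 2] by auto
  qed (auto simp: ey_def lookup_mono2 zero_prod_def)
  show "coef (ex i) 0 = 0" if i: "i \<in> {1..r}"
  proof (cases "a i = 1 \<and> b i = 0")
    case True
    then have "i = 1" using b_eq_0D i by simp
    then have "a 2 = 0" using a_dec[of 1 2] True r_ge_2 by auto
    then have "r = 2" using a_eq_0D[of 2] r_ge_2 by simp
    then show ?thesis using not_pure True \<open>i = 1\<close> \<open>a 2 = 0\<close> by simp
  qed (auto simp: ex_def lookup_mono2 zero_prod_def)
qed

lemma coef_0_M: "f \<in> M \<Longrightarrow> coef f 0 = 0"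
proof -
  have "(0, 0) \<notin> \<Delta>"
    using a_eq_0D b_eq_0D r_ge_2 by (force simp: \<Delta>_iff)
  then show "f \<in> M \<Longrightarrow> coef f 0 = 0" by (auto simp: in_M_iff zero_prod_def)
qed

section \<open>The three kernels on the level of polynomials\<close>

abbreviation x :: "'k poly2" where "x \<equiv> mono2 1 0"
abbreviation y :: "'k poly2" where "y \<equiv> mono2 0 1"

text \<open>
  Kernel of \<open>\<partial>\<^sub>1\<close> against image of \<open>\<partial>\<^sub>2\<close>, for lifts: \<open>g i\<close> is the coefficient of \<open>e\<^sub>f\<^sub>i\<close> and \<open>s\<close> that of the
  last basis element. After removing the combination of generators from \<open>x p + y q\<close> the relation holds in
  \<open>k[x, y]\<close> itself, where the Koszul complex is exact.
\<close>

lemma lifted_kernel_1: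
  "x * p + y * q \<in> M \<longleftrightarrow>
    (\<exists>g s. p - ((\<Sum>i\<in>{1..r}. g i * ex i) - s * y) \<in> M \<and> q - ((\<Sum>i\<in>{1..r}. g i * ey i) + s * x) \<in> M)"
proof
  assume "x * p + y * q \<in> M"
  then obtain g where g: "x * p + y * q = (\<Sum>i\<in>{1..r}. g i * (x * ex i + y * ey i))"
    by (rule M_span)
  (* By linearity the corrected pair (p, q) is a syzygy of (x, y) over the polynomial ring. *)
  have "x * (p - (\<Sum>i\<in>{1..r}. g i * ex i)) + y * (q - (\<Sum>i\<in>{1..r}. g i * ey i)) =
      x * p + y * q - (\<Sum>i\<in>{1..r}. g i * (x * ex i + y * ey i))"
    by (simp add: algebra_simps sum_distrib_left sum.distrib)
  then have "x * (p - (\<Sum>i\<in>{1..r}. g i * ex i)) + y * (q - (\<Sum>i\<in>{1..r}. g i * ey i)) = 0"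
    unfolding g by (simp only: diff_self)
  then obtain s where "p - (\<Sum>i\<in>{1..r}. g i * ex i) = - (y * s)" "q - (\<Sum>i\<in>{1..r}. g i * ey i) = x * s"
    by (rule koszul_exact)
  then have "p - ((\<Sum>i\<in>{1..r}. g i * ex i) - s * y) = 0" "q - ((\<Sum>i\<in>{1..r}. g i * ey i) + s * x) = 0"
    by (simp_all add: algebra_simps)
  then show "\<exists>g s. p - ((\<Sum>i\<in>{1..r}. g i * ex i) - s * y) \<in> M \<and> q - ((\<Sum>i\<in>{1..r}. g i * ey i) + s * x) \<in> M"
    by (intro exI[of _ g] exI[of _ s] conjI) (simp_all only: M_0)
next
  assume "\<exists>g s. p - ((\<Sum>i\<in>{1..r}. g i * ex i) - s * y) \<in> M \<and> q - ((\<Sum>i\<in>{1..r}. g i * ey i) + s * x) \<in> M"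
  then obtain g s where gs: "p - ((\<Sum>i\<in>{1..r}. g i * ex i) - s * y) \<in> M"
    "q - ((\<Sum>i\<in>{1..r}. g i * ey i) + s * x) \<in> M" by blast
  have "x * p + y * q = x * (p - ((\<Sum>i\<in>{1..r}. g i * ex i) - s * y))
      + y * (q - ((\<Sum>i\<in>{1..r}. g i * ey i) + s * x)) + (\<Sum>i\<in>{1..r}. g i * (x * ex i + y * ey i))"
    by (simp add: algebra_simps sum_distrib_left sum.distrib)
  also have "\<dots> \<in> M"
    by (rule M_add[OF M_add[OF M_mult[OF gs(1)] M_mult[OF gs(2)]] M_sum], rule M_mult, rule generator_in_M)
  finally show "x * p + y * q \<in> M" .
qed

text \<open>
  Kernel of \<open>\<partial>\<^sub>2\<close> against image of \<open>\<partial>\<^sub>3\<close>, for lifts. Adding \<open>x\<close> times the first component and \<open>y\<close> times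
  the second gives \<open>\<Sum> s i m\<^sub>i\<close>, because the Koszul terms in \<open>s'\<close> cancel. This puts the \<open>s i\<close> into \<open>(x, y)\<close>, and
  the rest of the element is supported on the last basis element with a coefficient killed by \<open>x\<close> and
  \<open>y\<close>.
\<close>

lemma lifted_kernel_2:
  "(\<Sum>i\<in>{1..r}. s i * ex i) - s' * y \<in> M \<and> (\<Sum>i\<in>{1..r}. s i * ey i) + s' * x \<in> M \<longleftrightarrow>
    (\<exists>p q t. (\<forall>i\<in>{1..r}. s i - (p i * x + q i * y) \<in> M) \<and>
      s' - ((\<Sum>i\<in>{1..r}. q i * ex i - p i * ey i) + (\<Sum>j\<in>{1..r - 1}. t j * w j)) \<in> M)"
    (is "?u \<in> M \<and> ?v \<in> M \<longleftrightarrow> ?R")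
proof
  assume uv: "?u \<in> M \<and> ?v \<in> M"
  have "(\<Sum>i\<in>{1..r}. s i * (x * ex i + y * ey i)) = x * ?u + y * ?v"
    by (simp add: algebra_simps sum_distrib_left sum.distrib)
  then have "coef (s i) 0 = 0" if "i \<in> {1..r}" for i
    using generators_minimal[of s ?u ?v i] uv that by blast
  then have "\<forall>i\<in>{1..r}. \<exists>pq. s i = x * fst pq + y * snd pq"
    unfolding lookup_0_eq_0_iff by force
  then obtain pq where pq: "\<And>i. i \<in> {1..r} \<Longrightarrow> s i = x * fst (pq i) + y * snd (pq i)"
    by metis
  define p q where "p = fst \<circ> pq" and "q = snd \<circ> pq"
  have s: "s i = x * p i + y * q i" if "i \<in> {1..r}" for i
    using pq[OF that] by (simp add: p_def q_def)
  (* The coefficient of the last basis element after subtracting the images of the elements of F_3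
     that remove the coordinates s i. *)
  define z where "z = s' - (\<Sum>i\<in>{1..r}. q i * ex i - p i * ey i)"
  have u: "?u = (\<Sum>i\<in>{1..r}. (x * p i + y * q i) * ex i) - s' * y"
    and v: "?v = (\<Sum>i\<in>{1..r}. (x * p i + y * q i) * ey i) + s' * x"
    using s by simp_all
  have "?u \<in> M" "?v \<in> M" using uv by blast+
  have yz: "y * z = (\<Sum>i\<in>{1..r}. p i * (x * ex i + y * ey i)) - ?u"
    unfolding u z_def by (simp add: algebra_simps sum_distrib_left sum.distrib sum_subtractf)
  have xz: "x * z = ?v - (\<Sum>i\<in>{1..r}. q i * (x * ex i + y * ey i))"
    unfolding v z_def by (simp add: algebra_simps sum_distrib_left sum.distrib sum_subtractf)
  have "x * z \<in> M"
    unfolding xz by (rule M_diff[OF \<open>?v \<in> M\<close> M_sum], rule M_mult, rule generator_in_M)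
  moreover have "y * z \<in> M"
    unfolding yz by (rule M_diff[OF M_sum \<open>?u \<in> M\<close>], rule M_mult, rule generator_in_M)
  ultimately obtain t where "z - (\<Sum>j\<in>{1..r - 1}. t j * w j) \<in> M" by (rule socle_span)
  then have "s' - ((\<Sum>i\<in>{1..r}. q i * ex i - p i * ey i) + (\<Sum>j\<in>{1..r - 1}. t j * w j)) \<in> M"
    by (simp add: z_def algebra_simps)
  moreover have "\<forall>i\<in>{1..r}. s i - (p i * x + q i * y) \<in> M"
    by (simp add: s mult.commute del: One_nat_def)
  ultimately show ?R by blast
next
  assume ?R
  then obtain p q t where s: "\<forall>i\<in>{1..r}. s i - (p i * x + q i * y) \<in> M"
    and s': "s' - ((\<Sum>i\<in>{1..r}. q i * ex i - p i * ey i) + (\<Sum>j\<in>{1..r - 1}. t j * w j)) \<in> M"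
      (is "s' - ?S \<in> M") by blast
  have S: "(\<Sum>i\<in>{1..r}. (s i - (p i * x + q i * y)) * e i) \<in> M" for e
    by (rule M_sum, rule M_mult', rule s[rule_format])
  have G: "(\<Sum>i\<in>{1..r}. g i * (x * ex i + y * ey i)) \<in> M" for g
    by (rule M_sum, rule M_mult, rule generator_in_M)
  have W: "(\<Sum>j\<in>{1..r - 1}. t j * (y * w j)) \<in> M" "(\<Sum>j\<in>{1..r - 1}. t j * (x * w j)) \<in> M"
    by (rule M_sum, rule M_mult, erule w_killed)+
  have "?u = (\<Sum>i\<in>{1..r}. (s i - (p i * x + q i * y)) * ex i) - (s' - ?S) * y
      + (\<Sum>i\<in>{1..r}. p i * (x * ex i + y * ey i)) - (\<Sum>j\<in>{1..r - 1}. t j * (y * w j))"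
    by (simp add: algebra_simps sum_distrib_left sum.distrib sum_subtractf)
  also have "\<dots> \<in> M"
    by (rule M_diff[OF M_add[OF M_diff[OF S M_mult'[OF s']] G] W(1)])
  finally have u: "?u \<in> M" .
  have "?v = (\<Sum>i\<in>{1..r}. (s i - (p i * x + q i * y)) * ey i) + (s' - ?S) * x
      + (\<Sum>i\<in>{1..r}. q i * (x * ex i + y * ey i)) + (\<Sum>j\<in>{1..r - 1}. t j * (x * w j))"
    by (simp add: algebra_simps sum_distrib_left sum.distrib sum_subtractf)
  also have "\<dots> \<in> M"
    by (rule M_add[OF M_add[OF M_add[OF S M_mult'[OF s']] G] W(2)])
  finally have "?v \<in> M" .
  with u show "?u \<in> M \<and> ?v \<in> M" by blast
qed

text \<open>
  Modulo \<open>M\<close>, the pair \<open>(p, q)\<close> is a combination of \<open>(- y, x)\<close>, whose determinant with \<open>(ex i, ey i)\<close> is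
  the generator \<open>m\<^sub>i\<close>, and of pairs \<open>(ex j, ey j)\<close>, whose determinants with \<open>(ex i, ey i)\<close> consist of mixed
  products.
\<close>

lemma determinant_in_M:
  assumes "x * p + y * q \<in> M" and i: "i \<in> {1..r}"
  shows "q * ex i - p * ey i \<in> M"
proof -
  obtain g s where p: "p - ((\<Sum>j\<in>{1..r}. g j * ex j) - s * y) \<in> M" (is "p - ?P \<in> M")
    and q: "q - ((\<Sum>j\<in>{1..r}. g j * ey j) + s * x) \<in> M" (is "q - ?Q \<in> M")
    using assms(1) unfolding lifted_kernel_1 by blast
  have "q * ex i - p * ey i = (q - ?Q) * ex i - (p - ?P) * ey i
      + (\<Sum>j\<in>{1..r}. g j * (ex i * ey j - ex j * ey i)) + s * (x * ex i + y * ey i)"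
    by (simp add: algebra_simps sum_distrib_left sum.distrib sum_subtractf)
  also have "\<dots> \<in> M"
    by (rule M_add[OF M_add[OF M_diff[OF M_mult'[OF q] M_mult'[OF p]] M_sum] M_mult[OF generator_in_M[OF i]]],
        rule M_mult, rule M_diff, (rule ex_ey_in_M i, assumption?)+)
  finally show ?thesis .
qed

text \<open>
  The kernel of \<open>\<partial>\<^sub>3\<close>, for lifts, is described by separate conditions on the pairs \<open>(p i, q i)\<close> and on the
  \<open>t j\<close>: the determinants are in \<open>M\<close> already, so the coefficients of the corner monomials are on their
  own.
\<close>

lemma lifted_kernel_3:
  "(\<forall>i\<in>{1..r}. p i * x + q i * y \<in> M) \<and>
      (\<Sum>i\<in>{1..r}. q i * ex i - p i * ey i) + (\<Sum>j\<in>{1..r - 1}. t j * w j) \<in> M \<longleftrightarrow>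
    (\<forall>i\<in>{1..r}. p i * x + q i * y \<in> M) \<and> (\<forall>j\<in>{1..r - 1}. coef (t j) 0 = 0)"
proof (intro conj_cong refl)
  assume pq: "\<forall>i\<in>{1..r}. p i * x + q i * y \<in> M"
  have D: "(\<Sum>i\<in>{1..r}. q i * ex i - p i * ey i) \<in> M"
    using pq by (intro M_sum determinant_in_M) (simp_all add: mult.commute)
  show "(\<Sum>i\<in>{1..r}. q i * ex i - p i * ey i) + (\<Sum>j\<in>{1..r - 1}. t j * w j) \<in> M \<longleftrightarrow>
      (\<forall>j\<in>{1..r - 1}. coef (t j) 0 = 0)"
  proof
    assume "(\<Sum>i\<in>{1..r}. q i * ex i - p i * ey i) + (\<Sum>j\<in>{1..r - 1}. t j * w j) \<in> M"
    from M_diff[OF this D] have "(\<Sum>j\<in>{1..r - 1}. t j * w j) \<in> M" by simp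
    then show "\<forall>j\<in>{1..r - 1}. coef (t j) 0 = 0" using socle_minimal by blast
  next
    assume t: "\<forall>j\<in>{1..r - 1}. coef (t j) 0 = 0"
    have "t j * w j \<in> M" if j: "j \<in> {1..r - 1}" for j
    proof -
      obtain p q where pq: "t j = x * p + y * q" using t j lookup_0_eq_0_iff[of "t j"] by blast
      have "t j * w j = p * (x * w j) + q * (y * w j)" by (simp add: pq algebra_simps)
      then show ?thesis using M_add[OF M_mult[OF w_killed(1)[OF j]] M_mult[OF w_killed(2)[OF j]], of p q] by (simp only:)
    qed
    then show "(\<Sum>i\<in>{1..r}. q i * ex i - p i * ey i) + (\<Sum>j\<in>{1..r - 1}. t j * w j) \<in> M"
      by (rule M_add[OF D M_sum])
  qed
qed

section \<open>Residue classes modulo the monomial ideal\<close>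

abbreviation S where "S \<equiv> quot_ring M"

definition cls :: "'k poly2 \<Rightarrow> 'k poly2 set"
  where "cls f = M +>\<^bsub>kxy\<^esub> f"

lemma quot_mono_eq: "quot_mono M p q = cls (mono2 p q)"
  by (simp add: quot_mono_def cls_def)

lemma cring_kxy: "cring (kxy :: 'k poly2 ring)"
  unfolding kxy_def by (rule cring_from_type_algebra)

lemma cring_S: "cring S"
  unfolding quot_ring_def by (rule ideal.quotient_is_cring[OF ideal_M cring_kxy])

lemma cls_hom: "cls \<in> ring_hom kxy S"
  using ideal.rcos_ring_hom[OF ideal_M] by (simp add: cls_def[abs_def] quot_ring_def)

lemma kxy_simps:
  "carrier (kxy :: 'k poly2 ring) = UNIV" "(f :: 'k poly2) \<oplus>\<^bsub>kxy\<^esub> g = f + g" "f \<otimes>\<^bsub>kxy\<^esub> g = f * g"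
  "\<one>\<^bsub>kxy\<^esub> = (1 :: 'k poly2)" "\<zero>\<^bsub>kxy\<^esub> = (0 :: 'k poly2)"
  by (simp_all add: kxy_def ring_of_type_algebra_def)

lemma cls_add: "cls f \<oplus>\<^bsub>S\<^esub> cls g = cls (f + g)"
  using ring_hom_add[OF cls_hom] by (simp add: kxy_simps)

lemma cls_mult: "cls f \<otimes>\<^bsub>S\<^esub> cls g = cls (f * g)"
  using ring_hom_mult[OF cls_hom] by (simp add: kxy_simps)

lemma cls_one: "\<one>\<^bsub>S\<^esub> = cls 1"
  using ring_hom_one[OF cls_hom] by (simp add: kxy_simps)

lemma cls_in_carrier [simp]: "cls f \<in> carrier S"
  using ring_hom_closed[OF cls_hom] by (simp add: kxy_simps)

lemma cls_zero: "\<zero>\<^bsub>S\<^esub> = cls 0"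
  using ring_hom_zero[OF cls_hom] cring_S cring_kxy by (simp add: kxy_simps cring_def)

lemma carrier_S: "carrier S = range cls"
  by (auto simp: quot_ring_def FactRing_def A_RCOSETS_defs cls_def a_r_coset_def kxy_simps[unfolded])

lemma cls_eq_iff: "cls f = cls g \<longleftrightarrow> f - g \<in> M"
proof -
  interpret R: cring "kxy :: 'k poly2 ring" by (rule cring_kxy)
  have inv: "\<ominus>\<^bsub>kxy\<^esub> g = - g"
    by (rule R.minus_equality) (simp_all add: kxy_simps)
  show ?thesis
    using R.quotient_eq_iff_same_a_r_cos[OF ideal_M, of f g] inv
    by (simp add: kxy_simps a_minus_def cls_def)
qed

lemma one_not_zero_S: "\<one>\<^bsub>S\<^esub> \<noteq> \<zero>\<^bsub>S\<^esub>"
  using coef_0_M[of 1] by (auto simp: cls_one cls_zero cls_eq_iff)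

lemma cls_sum: "finite A \<Longrightarrow> (\<Oplus>\<^bsub>S\<^esub>e\<in>A. cls (f e)) = cls (\<Sum>e\<in>A. f e)"
proof (induction A rule: finite_induct)
  interpret S: cring S by (rule cring_S)
  {
    case empty
    show ?case by (simp add: cls_zero)
  next
    case (insert e A)
    then show ?case by (subst S.finsum_insert) (auto simp: cls_add)
  }
qed

lemma ideal_xy: "ideal (xy_ideal M) S"
proof -
  interpret S: cring S by (rule cring_S)
  show ?thesis unfolding xy_ideal_def by (rule S.genideal_ideal) (simp add: quot_mono_eq)
qed

text \<open>
  Well defined on classes because every element of \<open>M\<close> has constant term \<open>0\<close>.
\<close>

lemma cls_in_xy_ideal_iff: "cls f \<in> xy_ideal M \<longleftrightarrow> coef f 0 = 0"
proof
  interpret R: cring "kxy :: 'k poly2 ring" by (rule cring_kxy)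
  interpret S: cring S by (rule cring_S)
  interpret I: ideal "xy_ideal M" S by (rule ideal_xy)
  let ?J = "{f :: 'k poly2. coef f 0 = 0}"
  have "ideal ?J kxy"
    by (rule ideal_kxyI) (auto simp: lookup_add lookup_0_mult mult.commute)
  from R.ring_ideal_imp_quot_ideal[OF ideal_M this]
  have "ideal (cls ` ?J) S" by (simp add: cls_def[abs_def] quot_ring_def)
  moreover have "{cls x, cls y} \<subseteq> cls ` ?J"
    by (auto intro!: imageI simp: lookup_mono2 zero_prod_def)
  ultimately have sub: "xy_ideal M \<subseteq> cls ` ?J"
    unfolding xy_ideal_def quot_mono_eq by (rule S.genideal_minimal)
  {
    assume "cls f \<in> xy_ideal M"
    then obtain g where g: "coef g 0 = 0" "f - g \<in> M" using sub by (auto simp: cls_eq_iff)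
    then show "coef f 0 = 0" using coef_0_M[OF g(2)] by (simp add: lookup_minus)
  next
    assume "coef f 0 = 0"
    then obtain p q where f: "f = x * p + y * q" unfolding lookup_0_eq_0_iff by blast
    have "cls x \<in> xy_ideal M" "cls y \<in> xy_ideal M"
      unfolding xy_ideal_def quot_mono_eq using S.genideal_self[of "{cls x, cls y}"] by auto
    then have "cls x \<otimes>\<^bsub>S\<^esub> cls p \<oplus>\<^bsub>S\<^esub> cls y \<otimes>\<^bsub>S\<^esub> cls q \<in> xy_ideal M"
      by (intro I.a_closed I.I_r_closed) auto
    then show "cls f \<in> xy_ideal M" by (simp add: f cls_add cls_mult)
  }
qed

text \<open>
  An element of a free \<open>S\<close>-module given by polynomial lifts of its coordinates, so that computations take
  place in the polynomial ring modulo \<open>M\<close>.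
\<close>

definition vec :: "'b set \<Rightarrow> ('b \<Rightarrow> 'k poly2) \<Rightarrow> 'b \<Rightarrow> 'k poly2 set"
  where "vec B U = (\<lambda>e\<in>B. cls (U e))"

lemma vec_in_carrier [simp]: "vec B U \<in> carrier (free_mod S B)"
  by (auto simp: vec_def free_mod_simps)

lemma vec_eq_iff: "vec B U = vec B V \<longleftrightarrow> (\<forall>e\<in>B. U e - V e \<in> M)"
  by (auto simp: vec_def fun_eq_iff restrict_def cls_eq_iff)

lemma vec_cong: "(\<And>e. e \<in> B \<Longrightarrow> U e = V e) \<Longrightarrow> vec B U = vec B V"
  by (simp add: vec_eq_iff)

lemma vec_cases:
  assumes "u \<in> carrier (free_mod S B)"
  obtains U where "u = vec B U"
proof -
  have "\<forall>e\<in>B. \<exists>f. u e = cls f" using assms by (auto simp: free_mod_simps carrier_S)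
  then obtain U where "\<forall>e\<in>B. u e = cls (U e)" by metis
  then have "u = vec B U"
    using assms by (auto simp: vec_def free_mod_simps fun_eq_iff PiE_iff extensional_def)
  then show thesis by (rule that)
qed

lemma vec_simps:
  "\<zero>\<^bsub>free_mod S B\<^esub> = vec B (\<lambda>_. 0)"
  "vec B U \<oplus>\<^bsub>free_mod S B\<^esub> vec B V = vec B (\<lambda>e. U e + V e)"
  "cls c \<odot>\<^bsub>free_mod S B\<^esub> vec B U = vec B (\<lambda>e. c * U e)"
  "\<ominus>\<^bsub>free_mod S B\<^esub> vec B U = vec B (\<lambda>e. - U e)"
  "vec B U \<ominus>\<^bsub>free_mod S B\<^esub> vec B V = vec B (\<lambda>e. U e - V e)"
  "basis_vec S B g = vec B (\<lambda>e. if e = g then 1 else 0)"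
proof -
  interpret F: module S "free_mod S B" by (rule module_free_mod[OF cring_S])
  show zero: "\<zero>\<^bsub>free_mod S B\<^esub> = vec B (\<lambda>_. 0)"
    by (simp add: free_mod_simps vec_def cls_zero)
  show add: "vec B U \<oplus>\<^bsub>free_mod S B\<^esub> vec B V = vec B (\<lambda>e. U e + V e)" for U V
    by (auto simp: free_mod_simps vec_def cls_add intro!: restrict_ext)
  show "cls c \<odot>\<^bsub>free_mod S B\<^esub> vec B U = vec B (\<lambda>e. c * U e)"
    by (auto simp: free_mod_simps vec_def cls_mult intro!: restrict_ext)
  show uminus: "\<ominus>\<^bsub>free_mod S B\<^esub> vec B U = vec B (\<lambda>e. - U e)" for U
    by (rule F.M.minus_equality) (simp_all add: add zero)
  show "vec B U \<ominus>\<^bsub>free_mod S B\<^esub> vec B V = vec B (\<lambda>e. U e - V e)"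
    by (simp add: a_minus_def uminus add)
  show "basis_vec S B g = vec B (\<lambda>e. if e = g then 1 else 0)"
    by (auto simp: basis_vec_def vec_def cls_one cls_zero intro!: restrict_ext)
qed

text \<open>
  On lifts a linear extension is multiplication by a matrix of polynomials.
\<close>

lemma linear_extension_vec:
  assumes "finite B" "\<And>e. e \<in> B \<Longrightarrow> \<phi> e = vec B' (\<Phi> e)"
  shows "linear_extension S B (free_mod S B') \<phi> (vec B U) = vec B' (\<lambda>g. \<Sum>e\<in>B. U e * \<Phi> e g)"
proof (rule free_mod_eqI[of _ S B'])
  interpret S: cring S by (rule cring_S)
  have \<phi>: "\<phi> \<in> B \<rightarrow> carrier (free_mod S B')" using assms(2) by simp
  show "linear_extension S B (free_mod S B') \<phi> (vec B U) \<in> carrier (free_mod S B')"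
    using linear_extension_in_module_homs[OF module_free_mod[OF cring_S] assms(1) \<phi>]
    by (auto simp: module_homs_def)
  fix g assume g: "g \<in> B'"
  have "linear_extension S B (free_mod S B') \<phi> (vec B U) g = (\<Oplus>\<^bsub>S\<^esub>e\<in>B. vec B U e \<otimes>\<^bsub>S\<^esub> \<phi> e g)"
    by (rule linear_extension_free_mod_apply[OF cring_S assms(1) \<phi> _ g]) simp
  also have "\<dots> = (\<Oplus>\<^bsub>S\<^esub>e\<in>B. cls (U e * \<Phi> e g))"
    using assms g by (intro S.finsum_cong') (auto simp: vec_def cls_mult)
  also have "\<dots> = vec B' (\<lambda>g. \<Sum>e\<in>B. U e * \<Phi> e g) g"
    using g assms(1) by (simp add: cls_sum vec_def)
  finally show "linear_extension S B (free_mod S B') \<phi> (vec B U) g = vec B' (\<lambda>g. \<Sum>e\<in>B. U e * \<Phi> e g) g" .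
qed simp

section \<open>Matrices of the three maps\<close>

text \<open>
  Together with \<open>coords2\<close> and \<open>coords3\<close>: coordinate functions on the bases of \<open>F\<^sub>1\<close>, \<open>F\<^sub>2\<close> and \<open>F\<^sub>3\<close>, with
  the coordinates grouped as in the polynomial computations.
\<close>

definition coords1 :: "'k poly2 \<Rightarrow> 'k poly2 \<Rightarrow> gen \<Rightarrow> 'k poly2"
  where "coords1 p q e = (case e of E_x \<Rightarrow> p | E_y \<Rightarrow> q | _ \<Rightarrow> 0)"

definition coords2 :: "(nat \<Rightarrow> 'k poly2) \<Rightarrow> 'k poly2 \<Rightarrow> gen \<Rightarrow> 'k poly2"
  where "coords2 g s e = (case e of E_f i \<Rightarrow> if i = r + 1 then s else g i | _ \<Rightarrow> 0)"

definition coords3 :: "(nat \<Rightarrow> 'k poly2) \<Rightarrow> (nat \<Rightarrow> 'k poly2) \<Rightarrow> (nat \<Rightarrow> 'k poly2) \<Rightarrow> gen \<Rightarrow> 'k poly2"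
  where "coords3 p q t e = (case e of E_cx i \<Rightarrow> p i | E_cy i \<Rightarrow> q i | E_d i \<Rightarrow> t i | _ \<Rightarrow> 0)"

text \<open>
  A matrix of polynomials for \<open>\<partial>\<^sub>j\<close>: \<open>bd_mat j e\<close> is the coordinate function of the image of the basis
  element \<open>e\<close>.
\<close>

definition bd_mat :: "nat \<Rightarrow> gen \<Rightarrow> gen \<Rightarrow> 'k poly2"
  where "bd_mat j e =
    (if j = 1 then (\<lambda>_. coords1 x y e)
     else if j = 2 then
       (case e of E_f i \<Rightarrow> if i = r + 1 then coords1 (- y) x else coords1 (ex i) (ey i) | _ \<Rightarrow> \<lambda>_. 0)
     else
       (case e of
          E_cx i \<Rightarrow> coords2 (\<lambda>k. if k = i then x else 0) (- ey i)
        | E_cy i \<Rightarrow> coords2 (\<lambda>k. if k = i then y else 0) (ex i)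
        | E_d i \<Rightarrow> coords2 (\<lambda>_. 0) (w i)
        | _ \<Rightarrow> \<lambda>_. 0))"

lemma F_basis_simps:
  "F_basis r 0 = {E_1}" "F_basis r 1 = {E_x, E_y}" "F_basis r (Suc 0) = {E_x, E_y}"
  "F_basis r 2 = E_f ` {1..r + 1}"
  "F_basis r 3 = E_cx ` {1..r} \<union> E_cy ` {1..r} \<union> E_d ` {1..r - 1}"
  by (simp_all add: F_basis_def)

lemma finite_F_basis: "finite (F_basis r j)"
  by (simp add: F_basis_def)

lemma sum_F_basis_2: "(\<Sum>e\<in>F_basis r 2. h e) = (\<Sum>i\<in>{1..r}. h (E_f i)) + h (E_f (r + 1))"
  by (simp add: F_basis_simps sum.reindex inj_on_def)

lemma sum_F_basis_3:
  "(\<Sum>e\<in>F_basis r 3. h e) =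
    (\<Sum>i\<in>{1..r}. h (E_cx i)) + (\<Sum>i\<in>{1..r}. h (E_cy i)) + (\<Sum>i\<in>{1..r - 1}. h (E_d i))"
proof -
  have "(\<Sum>e\<in>F_basis r 3. h e) =
      (\<Sum>e\<in>E_cx ` {1..r}. h e) + (\<Sum>e\<in>E_cy ` {1..r}. h e) + (\<Sum>e\<in>E_d ` {1..r - 1}. h e)"
    unfolding F_basis_simps by (subst sum.union_disjoint; (subst sum.union_disjoint)?) auto
  then show ?thesis by (simp add: sum.reindex inj_on_def)
qed

lemma bd1_gen_vec: "e \<in> F_basis r 1 \<Longrightarrow> bd1_gen M r e = vec (F_basis r 0) (bd_mat 1 e)"
  by (auto simp: F_basis_simps bd1_gen_def Let_def F_mod_def F_vec_def vec_simps quot_mono_eq bd_mat_def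
      coords1_def intro!: vec_cong)

lemma bd2_gen_vec:
  assumes "e \<in> F_basis r 2"
  shows "bd2_gen M r a b e = vec (F_basis r 1) (bd_mat 2 e)"
proof -
  obtain i where i: "e = E_f i" "i \<in> {1..r + 1}" using assms by (auto simp: F_basis_simps)
  consider "i = r + 1" | "i = r" "a r = 0" | "i \<in> {1..r}" "a i > 0" "\<not> (i = r \<and> a r = 0)"
    using i a_pos[of i] by (metis Suc_eq_plus1 atLeastAtMost_iff le_SucE le_neq_implies_less neq0_conv)
  then show ?thesis
    by cases (auto simp: i bd2_gen_def Let_def F_mod_def F_vec_def vec_simps quot_mono_eq bd_mat_def
      F_basis_simps coords1_def ex_def ey_def intro!: vec_cong)
qed

lemma bd3_gen_vec:
  assumes "e \<in> F_basis r 3"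
  shows "bd3_gen M r a b e = vec (F_basis r 2) (bd_mat 3 e)"
proof -
  consider i where "e = E_cx i" "i \<in> {1..r}" | i where "e = E_cy i" "i \<in> {1..r}"
    | i where "e = E_d i" "i \<in> {1..r - 1}"
    using assms by (auto simp: F_basis_simps)
  then show ?thesis
  proof cases
    case (1 i)
    then have "a i > 0 \<or> i = r \<and> a r = 0" using a_pos[of i] by force
    with 1 show ?thesis
      by (auto simp: bd3_gen_def Let_def F_mod_def F_vec_def vec_simps quot_mono_eq bd_mat_def
        F_basis_simps coords2_def ex_def ey_def intro!: vec_cong)
  next
    case (2 i)
    then have "a i > 0 \<or> i = r \<and> a r = 0" using a_pos[of i] by force
    with 2 show ?thesis
      by (auto simp: bd3_gen_def Let_def F_mod_def F_vec_def vec_simps quot_mono_eq bd_mat_def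
        F_basis_simps coords2_def ex_def ey_def intro!: vec_cong)
  next
    case (3 i)
    then show ?thesis
      by (auto simp: bd3_gen_def Let_def F_mod_def F_vec_def vec_simps quot_mono_eq bd_mat_def
        F_basis_simps coords2_def w_def intro!: vec_cong)
  qed
qed

lemma bd_gen_vec:
  assumes "j \<in> {1, 2, 3}" "e \<in> F_basis r j"
  shows "(if j = 1 then bd1_gen M r else if j = 2 then bd2_gen M r a b else bd3_gen M r a b) e
    = vec (F_basis r (j - 1)) (bd_mat j e)"
  using assms bd1_gen_vec bd2_gen_vec bd3_gen_vec by auto

lemma bd_vec:
  assumes "j \<in> {1, 2, 3}"
  shows "bd M r a b j (vec (F_basis r j) U) = vec (F_basis r (j - 1)) (\<lambda>g. \<Sum>e\<in>F_basis r j. U e * bd_mat j e g)"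
  unfolding bd_def F_mod_def
  by (rule linear_extension_vec[OF finite_F_basis bd_gen_vec[OF assms]])

lemma bd_in_module_homs:
  assumes "j \<in> {1, 2, 3}"
  shows "bd M r a b j \<in> module_homs S (F_mod M r j) (F_mod M r (j - 1))"
proof -
  have "linear_extension S (F_basis r j) (F_mod M r (j - 1))
      (if j = 1 then bd1_gen M r else if j = 2 then bd2_gen M r a b else bd3_gen M r a b)
    \<in> module_homs S (free_mod S (F_basis r j)) (F_mod M r (j - 1))"
    by (rule linear_extension_in_module_homs)
      (use bd_gen_vec[OF assms] in \<open>auto simp: F_mod_def finite_F_basis intro: module_free_mod cring_S\<close>)
  then show ?thesis by (simp add: bd_def F_mod_def)
qed

lemma coef_0_bd_mat: "e \<in> F_basis r j \<Longrightarrow> j \<in> {1, 2, 3} \<Longrightarrow> coef (bd_mat j e g) 0 = 0"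
  using coef_0_entries
  by (auto simp: bd_mat_def F_basis_simps coords1_def coords2_def lookup_mono2 zero_prod_def split: gen.splits)

lemma bd_minimal:
  assumes j: "j \<in> {1, 2, 3}" and u: "u \<in> carrier (F_mod M r j)" and g: "g \<in> F_basis r (j - 1)"
  shows "bd M r a b j u g \<in> xy_ideal M"
proof -
  obtain U where U: "u = vec (F_basis r j) U" using u unfolding F_mod_def by (rule vec_cases)
  have "coef (U e * bd_mat j e g) 0 = 0" if "e \<in> F_basis r j" for e
    using lookup_0_mult[OF coef_0_bd_mat[OF that j, of g], of "U e"] by (simp add: mult.commute)
  then show ?thesis
    using g by (simp add: U bd_vec[OF j]) (simp add: vec_def cls_in_xy_ideal_iff lookup_sum)
qed

lemma vec_in_F_mod: "vec (F_basis r j) U \<in> carrier (F_mod M r j)"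
  by (simp add: F_mod_def)

lemma vec_coords1_cases:
  assumes "u \<in> carrier (F_mod M r 1)"
  obtains p q where "u = vec (F_basis r 1) (coords1 p q)"
proof -
  obtain U where "u = vec (F_basis r 1) U" using assms unfolding F_mod_def by (rule vec_cases)
  then have "u = vec (F_basis r 1) (coords1 (U E_x) (U E_y))"
    by (auto simp: F_basis_simps coords1_def intro!: vec_cong)
  then show thesis by (rule that)
qed

lemma vec_coords2_cases:
  assumes "u \<in> carrier (F_mod M r 2)"
  obtains g s where "u = vec (F_basis r 2) (coords2 g s)"
proof -
  obtain U where "u = vec (F_basis r 2) U" using assms unfolding F_mod_def by (rule vec_cases)
  then have "u = vec (F_basis r 2) (coords2 (\<lambda>i. U (E_f i)) (U (E_f (r + 1))))"
    by (auto simp: F_basis_simps coords2_def intro!: vec_cong)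
  then show thesis by (rule that)
qed

lemma vec_coords3_cases:
  assumes "u \<in> carrier (F_mod M r 3)"
  obtains p q t where "u = vec (F_basis r 3) (coords3 p q t)"
proof -
  obtain U where "u = vec (F_basis r 3) U" using assms unfolding F_mod_def by (rule vec_cases)
  then have "u = vec (F_basis r 3) (coords3 (\<lambda>i. U (E_cx i)) (\<lambda>i. U (E_cy i)) (\<lambda>i. U (E_d i)))"
    by (auto simp: F_basis_simps coords3_def intro!: vec_cong)
  then show thesis by (rule that)
qed

lemma vec_coords_eq_iff:
  "vec (F_basis r 1) (coords1 p q) = vec (F_basis r 1) (coords1 p' q') \<longleftrightarrow> p - p' \<in> M \<and> q - q' \<in> M"
  "vec (F_basis r 2) (coords2 g s) = vec (F_basis r 2) (coords2 g' s') \<longleftrightarrow>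
    (\<forall>i\<in>{1..r}. g i - g' i \<in> M) \<and> s - s' \<in> M"
proof -
  show "vec (F_basis r 1) (coords1 p q) = vec (F_basis r 1) (coords1 p' q') \<longleftrightarrow> p - p' \<in> M \<and> q - q' \<in> M"
    by (simp add: vec_eq_iff F_basis_simps coords1_def)
  have "{1..r + 1} = insert (r + 1) {1..r}" by auto
  then show "vec (F_basis r 2) (coords2 g s) = vec (F_basis r 2) (coords2 g' s') \<longleftrightarrow>
      (\<forall>i\<in>{1..r}. g i - g' i \<in> M) \<and> s - s' \<in> M"
    unfolding vec_eq_iff F_basis_simps by (auto simp: coords2_def)
qed

lemma vec_coords_eq_0_iff:
  "vec (F_basis r 1) (coords1 p q) = vec (F_basis r 1) (\<lambda>_. 0) \<longleftrightarrow> p \<in> M \<and> q \<in> M"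
  "vec (F_basis r 2) (coords2 g s) = vec (F_basis r 2) (\<lambda>_. 0) \<longleftrightarrow> (\<forall>i\<in>{1..r}. g i \<in> M) \<and> s \<in> M"
proof -
  have "vec (F_basis r 1) (\<lambda>_. 0) = vec (F_basis r 1) (coords1 0 0)"
    "vec (F_basis r 2) (\<lambda>_. 0) = vec (F_basis r 2) (coords2 (\<lambda>_. 0) 0)"
    by (auto simp: F_basis_simps coords1_def coords2_def intro!: vec_cong)
  then show
    "vec (F_basis r 1) (coords1 p q) = vec (F_basis r 1) (\<lambda>_. 0) \<longleftrightarrow> p \<in> M \<and> q \<in> M"
    "vec (F_basis r 2) (coords2 g s) = vec (F_basis r 2) (\<lambda>_. 0) \<longleftrightarrow> (\<forall>i\<in>{1..r}. g i \<in> M) \<and> s \<in> M"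
    by (simp_all add: vec_coords_eq_iff del: One_nat_def)
qed

lemma bd_1_vec: "bd M r a b 1 (vec (F_basis r 1) (coords1 p q)) = vec (F_basis r 0) (\<lambda>_. x * p + y * q)"
  unfolding bd_vec[of 1, simplified]
  by (simp add: bd_vec) (auto simp: F_basis_simps coords1_def bd_mat_def mult.commute intro!: vec_cong)

lemma bd_2_vec:
  "bd M r a b 2 (vec (F_basis r 2) (coords2 g s)) =
    vec (F_basis r 1) (coords1 ((\<Sum>i\<in>{1..r}. g i * ex i) - s * y) ((\<Sum>i\<in>{1..r}. g i * ey i) + s * x))"
proof -
  have "(\<Sum>e\<in>F_basis r 2. coords2 g s e * bd_mat 2 e h) =
      coords1 ((\<Sum>i\<in>{1..r}. g i * ex i) - s * y) ((\<Sum>i\<in>{1..r}. g i * ey i) + s * x) h"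
    if "h \<in> F_basis r 1" for h
    unfolding sum_F_basis_2 using that
    by (auto simp: F_basis_simps coords1_def coords2_def bd_mat_def intro!: sum.cong)
  then show ?thesis by (simp add: bd_vec) (rule vec_cong, simp)
qed

lemma bd_3_vec:
  "bd M r a b 3 (vec (F_basis r 3) (coords3 p q t)) =
    vec (F_basis r 2) (coords2 (\<lambda>i. p i * x + q i * y)
      ((\<Sum>i\<in>{1..r}. q i * ex i - p i * ey i) + (\<Sum>j\<in>{1..r - 1}. t j * w j)))"
proof -
  have "(\<Sum>e\<in>F_basis r 3. coords3 p q t e * bd_mat 3 e h) =
      coords2 (\<lambda>i. p i * x + q i * y)
      ((\<Sum>i\<in>{1..r}. q i * ex i - p i * ey i) + (\<Sum>j\<in>{1..r - 1}. t j * w j)) h"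
    if h: "h \<in> F_basis r 2" for h
  proof -
    obtain k where k: "h = E_f k" "k \<in> {1..r + 1}" using h unfolding F_basis_simps by blast
    show ?thesis
    proof (cases "k = r + 1")
      case True
      then show ?thesis unfolding sum_F_basis_3
        by (simp add: k coords3_def coords2_def bd_mat_def sum_subtractf sum_negf)
    next
      case False
      then show ?thesis unfolding sum_F_basis_3 using k
        by (simp add: coords3_def coords2_def bd_mat_def if_distrib[of "\<lambda>z. _ * z"] cong: if_cong)
    qed
  qed
  then show ?thesis by (simp add: bd_vec) (rule vec_cong, simp)
qed

lemma kernel_bd_1:
  assumes "u \<in> carrier (F_mod M r 1)"
  shows "bd M r a b 1 u = \<zero>\<^bsub>F_mod M r 0\<^esub> \<longleftrightarrow> u \<in> bd M r a b 2 ` carrier (F_mod M r 2)"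
proof -
  obtain p q where u: "u = vec (F_basis r 1) (coords1 p q)" using assms by (rule vec_coords1_cases)
  have "bd M r a b 1 u = \<zero>\<^bsub>F_mod M r 0\<^esub> \<longleftrightarrow> x * p + y * q \<in> M"
    unfolding u bd_1_vec by (simp add: F_mod_def vec_simps vec_eq_iff F_basis_simps)
  also have "\<dots> \<longleftrightarrow> (\<exists>g s. u = bd M r a b 2 (vec (F_basis r 2) (coords2 g s)))"
    unfolding lifted_kernel_1 u bd_2_vec vec_coords_eq_iff ..
  also have "\<dots> \<longleftrightarrow> u \<in> bd M r a b 2 ` carrier (F_mod M r 2)"
    using vec_in_F_mod
    by (blast elim: vec_coords2_cases)
  finally show ?thesis .
qed

lemma kernel_bd_2:
  assumes "u \<in> carrier (F_mod M r 2)"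
  shows "bd M r a b 2 u = \<zero>\<^bsub>F_mod M r 1\<^esub> \<longleftrightarrow> u \<in> bd M r a b 3 ` carrier (F_mod M r 3)"
proof -
  obtain g s where u: "u = vec (F_basis r 2) (coords2 g s)" using assms by (rule vec_coords2_cases)
  have "bd M r a b 2 u = \<zero>\<^bsub>F_mod M r 1\<^esub> \<longleftrightarrow>
      (\<Sum>i\<in>{1..r}. g i * ex i) - s * y \<in> M \<and> (\<Sum>i\<in>{1..r}. g i * ey i) + s * x \<in> M"
    unfolding u bd_2_vec F_mod_def vec_simps vec_coords_eq_0_iff ..
  also have "\<dots> \<longleftrightarrow> (\<exists>p q t. u = bd M r a b 3 (vec (F_basis r 3) (coords3 p q t)))"
    unfolding lifted_kernel_2 u bd_3_vec vec_coords_eq_iff ..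
  also have "\<dots> \<longleftrightarrow> u \<in> bd M r a b 3 ` carrier (F_mod M r 3)"
    using vec_in_F_mod
    by (blast elim: vec_coords3_cases)
  finally show ?thesis .
qed

lemma image_bd_1:
  assumes "v \<in> carrier (F_mod M r 0)"
  shows "v \<in> bd M r a b 1 ` carrier (F_mod M r 1) \<longleftrightarrow> v E_1 \<in> xy_ideal M"
proof -
  obtain V where V: "v = vec (F_basis r 0) V" using assms unfolding F_mod_def by (rule vec_cases)
  have "v \<in> bd M r a b 1 ` carrier (F_mod M r 1) \<longleftrightarrow>
      (\<exists>p q. v = bd M r a b 1 (vec (F_basis r 1) (coords1 p q)))"
    using vec_in_F_mod
    by (blast elim: vec_coords1_cases)
  also have "\<dots> \<longleftrightarrow> (\<exists>p q. V E_1 - (x * p + y * q) \<in> M)"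
    unfolding bd_1_vec V vec_eq_iff by (simp add: F_basis_simps)
  also have "\<dots> \<longleftrightarrow> coef (V E_1) 0 = 0"
  proof
    assume "\<exists>p q. V E_1 - (x * p + y * q) \<in> M"
    then obtain p q where pq: "V E_1 - (x * p + y * q) \<in> M" by blast
    have "coef (x * p + y * q) 0 = 0" unfolding lookup_0_eq_0_iff by blast
    then show "coef (V E_1) 0 = 0" using coef_0_M[OF pq] by (simp add: lookup_minus)
  next
    assume "coef (V E_1) 0 = 0"
    then obtain p q where "V E_1 = x * p + y * q" unfolding lookup_0_eq_0_iff by blast
    then have "V E_1 - (x * p + y * q) \<in> M" by simp
    then show "\<exists>p q. V E_1 - (x * p + y * q) \<in> M" by blast
  qed
  also have "\<dots> \<longleftrightarrow> v E_1 \<in> xy_ideal M"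
    by (simp add: V vec_def F_basis_simps cls_in_xy_ideal_iff)
  finally show ?thesis .
qed

text \<open>
  In terms of the summands of \<open>F\<^sub>3\<close>: each of the \<open>r\<close> copies of \<open>F\<^sub>1\<close> must lie in the kernel of \<open>\<partial>\<^sub>1\<close>, that is,
  in the image of \<open>\<partial>\<^sub>2\<close>, and each of the \<open>r - 1\<close> copies of \<open>F\<^sub>0\<close> in the maximal ideal, that is, in the image
  of \<open>\<partial>\<^sub>1\<close>. The condition on the copies of \<open>F\<^sub>1\<close> is phrased as an image because this is the form in which the
  next map of the resolution meets it.
\<close>

lemma kernel_bd_3:
  assumes u: "u \<in> carrier (F_mod M r 3)"
  shows "bd M r a b 3 u = \<zero>\<^bsub>F_mod M r 2\<^esub> \<longleftrightarrow>
    (\<forall>i\<in>{1..r}. (\<lambda>g\<in>F_basis r 1. u (if g = E_x then E_cx i else E_cy i)) \<in> bd M r a b 2 ` carrier (F_mod M r 2)) \<and>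
    (\<forall>i\<in>{1..r - 1}. (\<lambda>g\<in>F_basis r 0. u (E_d i)) \<in> bd M r a b 1 ` carrier (F_mod M r 1))"
proof -
  obtain p q t where U: "u = vec (F_basis r 3) (coords3 p q t)" using u by (rule vec_coords3_cases)
  have pair: "(\<lambda>g\<in>F_basis r 1. u (if g = E_x then E_cx i else E_cy i)) = vec (F_basis r 1) (coords1 (p i) (q i))"
    if "i \<in> {1..r}" for i
    using that by (auto simp: U vec_def F_basis_simps coords1_def coords3_def intro!: restrict_ext)
  have "(\<lambda>g\<in>F_basis r 1. u (if g = E_x then E_cx i else E_cy i)) \<in> bd M r a b 2 ` carrier (F_mod M r 2)
      \<longleftrightarrow> p i * x + q i * y \<in> M" if i: "i \<in> {1..r}" for i
  proof -
    have "vec (F_basis r 1) (coords1 (p i) (q i)) \<in> carrier (F_mod M r 1)" by (simp add: F_mod_def)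
    from kernel_bd_1[OF this] show ?thesis
      unfolding pair[OF i] bd_1_vec by (simp add: F_mod_def vec_simps vec_eq_iff F_basis_simps mult.commute)
  qed
  moreover have "(\<lambda>g\<in>F_basis r 0. u (E_d i)) \<in> bd M r a b 1 ` carrier (F_mod M r 1) \<longleftrightarrow> coef (t i) 0 = 0"
    if i: "i \<in> {1..r - 1}" for i
  proof -
    have d: "u (E_d i) = cls (t i)" using i by (simp add: U vec_def F_basis_simps coords3_def)
    have "(\<lambda>g\<in>F_basis r 0. u (E_d i)) \<in> carrier (F_mod M r 0)"
      by (auto simp: F_mod_def free_mod_simps d)
    from image_bd_1[OF this] show ?thesis by (simp add: F_basis_simps d cls_in_xy_ideal_iff)
  qed
  moreover have "bd M r a b 3 u = \<zero>\<^bsub>F_mod M r 2\<^esub> \<longleftrightarrow>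
    (\<forall>i\<in>{1..r}. p i * x + q i * y \<in> M) \<and> (\<forall>j\<in>{1..r - 1}. coef (t j) 0 = 0)"
    unfolding U bd_3_vec F_mod_def vec_simps vec_coords_eq_0_iff lifted_kernel_3 ..
  ultimately show ?thesis by blast
qed

section \<open>Direct sums of the three maps\<close>

abbreviation image_bd :: "nat \<Rightarrow> (gen \<Rightarrow> 'k poly2 set) set"
  where "image_bd j \<equiv> bd M r a b j ` carrier (F_mod M r j)"

lemma sum_component_in_carrier:
  assumes "z \<in> carrier (F_sum M r ns)" "j < length ns" "l < ns ! j"
  shows "sum_component r j l z \<in> carrier (F_mod M r j)"
  using assms by (auto simp: F_sum_def F_mod_def free_mod_simps sum_component_def sum_basis_iff PiE_iff)

lemma F_sum_eqI:
  assumes "z \<in> carrier (F_sum M r ns)" "z' \<in> carrier (F_sum M r ns)"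
    and "\<And>j l. j < length ns \<Longrightarrow> l < ns ! j \<Longrightarrow> sum_component r j l z = sum_component r j l z'"
  shows "z = z'"
proof (rule free_mod_eqI[OF assms(1,2)[unfolded F_sum_def]])
  fix e assume "e \<in> sum_basis r ns"
  then obtain j l g where e: "e = (j, l, g)" "j < length ns" "l < ns ! j" "g \<in> F_basis r j"
    by (cases e) (auto simp: sum_basis_iff)
  from fun_cong[OF assms(3)[OF e(2,3)], of g] show "z e = z' e"
    using e by (simp add: sum_component_def)
qed

lemma sum_component_zero:
  "j < length ns \<Longrightarrow> l < ns ! j \<Longrightarrow> sum_component r j l \<zero>\<^bsub>F_sum M r ns\<^esub> = \<zero>\<^bsub>F_mod M r j\<^esub>"
  by (auto simp: F_sum_def F_mod_def free_mod_simps sum_component_def sum_basis_iff intro!: restrict_ext)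

lemma sum_component_add:
  "j < length ns \<Longrightarrow> l < ns ! j \<Longrightarrow>
    sum_component r j l (z \<oplus>\<^bsub>F_sum M r ns\<^esub> z') = sum_component r j l z \<oplus>\<^bsub>F_mod M r j\<^esub> sum_component r j l z'"
  by (auto simp: F_sum_def F_mod_def free_mod_simps sum_component_def sum_basis_iff intro!: restrict_ext)

lemma sum_component_smult:
  "j < length ns \<Longrightarrow> l < ns ! j \<Longrightarrow>
    sum_component r j l (s \<odot>\<^bsub>F_sum M r ns\<^esub> z) = s \<odot>\<^bsub>F_mod M r j\<^esub> sum_component r j l z"
  by (auto simp: F_sum_def F_mod_def free_mod_simps sum_component_def sum_basis_iff intro!: restrict_ext)

lemma module_F_sum: "Module.module S (F_sum M r ns)"
  unfolding F_sum_def by (rule module_free_mod[OF cring_S])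

lemma bd_hom:
  assumes "j < 3"
  shows "u \<in> carrier (F_mod M r (Suc j)) \<Longrightarrow> bd M r a b (Suc j) u \<in> carrier (F_mod M r j)"
    "u \<in> carrier (F_mod M r (Suc j)) \<Longrightarrow> v \<in> carrier (F_mod M r (Suc j)) \<Longrightarrow>
      bd M r a b (Suc j) (u \<oplus>\<^bsub>F_mod M r (Suc j)\<^esub> v) = bd M r a b (Suc j) u \<oplus>\<^bsub>F_mod M r j\<^esub> bd M r a b (Suc j) v"
    "u \<in> carrier (F_mod M r (Suc j)) \<Longrightarrow> s \<in> carrier S \<Longrightarrow>
      bd M r a b (Suc j) (s \<odot>\<^bsub>F_mod M r (Suc j)\<^esub> u) = s \<odot>\<^bsub>F_mod M r j\<^esub> bd M r a b (Suc j) u"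
proof -
  have "Suc j \<in> {1, 2, 3}" using assms by auto
  from bd_in_module_homs[OF this] show
    "u \<in> carrier (F_mod M r (Suc j)) \<Longrightarrow> bd M r a b (Suc j) u \<in> carrier (F_mod M r j)"
    "u \<in> carrier (F_mod M r (Suc j)) \<Longrightarrow> v \<in> carrier (F_mod M r (Suc j)) \<Longrightarrow>
      bd M r a b (Suc j) (u \<oplus>\<^bsub>F_mod M r (Suc j)\<^esub> v) = bd M r a b (Suc j) u \<oplus>\<^bsub>F_mod M r j\<^esub> bd M r a b (Suc j) v"
    "u \<in> carrier (F_mod M r (Suc j)) \<Longrightarrow> s \<in> carrier S \<Longrightarrow>
      bd M r a b (Suc j) (s \<odot>\<^bsub>F_mod M r (Suc j)\<^esub> u) = s \<odot>\<^bsub>F_mod M r j\<^esub> bd M r a b (Suc j) u"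
    by (auto simp: module_homs_def)
qed

lemma bd_sum_in_carrier:
  assumes "length ns \<le> 3" "z \<in> carrier (F_sum M r (0 # ns))"
  shows "bd_sum M r a b ns z \<in> carrier (F_sum M r ns)"
proof -
  have "bd M r a b (Suc j) (sum_component r (Suc j) l z) g \<in> carrier S"
    if "(j, l, g) \<in> sum_basis r ns" for j l g
  proof -
    have "sum_component r (Suc j) l z \<in> carrier (F_mod M r (Suc j))"
      using that by (intro sum_component_in_carrier[OF assms(2)]) (auto simp: sum_basis_iff)
    then have "bd M r a b (Suc j) (sum_component r (Suc j) l z) \<in> carrier (F_mod M r j)"
      using that assms(1) by (intro bd_hom) (auto simp: sum_basis_iff)
    then show ?thesis using that by (auto simp: F_mod_def free_mod_simps sum_basis_iff)
  qed
  then show ?thesis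
    using assms(2) by (auto simp: bd_sum_def F_sum_def free_mod_simps(1)[of S "sum_basis r ns"])
qed

lemma sum_component_bd_sum:
  assumes "length ns \<le> 3" "z \<in> carrier (F_sum M r (0 # ns))" "j < length ns" "l < ns ! j"
  shows "sum_component r j l (bd_sum M r a b ns z) = bd M r a b (Suc j) (sum_component r (Suc j) l z)"
proof -
  have "sum_component r (Suc j) l z \<in> carrier (F_mod M r (Suc j))"
    using assms by (intro sum_component_in_carrier[OF assms(2)]) auto
  then have "bd M r a b (Suc j) (sum_component r (Suc j) l z) \<in> carrier (F_mod M r j)"
    using assms by (intro bd_hom) auto
  then show ?thesis
    using assms by (auto simp: sum_component_def bd_sum_def F_mod_def free_mod_simps(1) sum_basis_iff
        fun_eq_iff PiE_iff extensional_def)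
qed

lemma bd_sum_in_module_homs:
  assumes ns: "length ns \<le> 3"
  shows "bd_sum M r a b ns \<in> module_homs S (F_sum M r (0 # ns)) (F_sum M r ns)"
proof -
  interpret D: module S "F_sum M r (0 # ns)" by (rule module_F_sum)
  interpret C: module S "F_sum M r ns" by (rule module_F_sum)
  note cl = bd_sum_in_carrier[OF ns]
  have comp: "sum_component r (Suc j) l z \<in> carrier (F_mod M r (Suc j))"
    if "z \<in> carrier (F_sum M r (0 # ns))" "j < length ns" "l < ns ! j" for z j l
    using that by (intro sum_component_in_carrier[OF that(1)]) auto
  show ?thesis
    unfolding module_homs_def
  proof (intro CollectI conjI ballI)
    show "bd_sum M r a b ns \<in> carrier (F_sum M r (0 # ns)) \<rightarrow> carrier (F_sum M r ns)"
      using cl by blast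
  next
    fix z z' assume z: "z \<in> carrier (F_sum M r (0 # ns))" "z' \<in> carrier (F_sum M r (0 # ns))"
    show "bd_sum M r a b ns (z \<oplus>\<^bsub>F_sum M r (0 # ns)\<^esub> z') =
        bd_sum M r a b ns z \<oplus>\<^bsub>F_sum M r ns\<^esub> bd_sum M r a b ns z'"
      using z ns
      by (intro F_sum_eqI[of _ ns]) (auto simp: cl comp sum_component_add sum_component_bd_sum bd_hom)
  next
    fix s z assume z: "s \<in> carrier S" "z \<in> carrier (F_sum M r (0 # ns))"
    show "bd_sum M r a b ns (s \<odot>\<^bsub>F_sum M r (0 # ns)\<^esub> z) = s \<odot>\<^bsub>F_sum M r ns\<^esub> bd_sum M r a b ns z"
      using z ns
      by (intro F_sum_eqI[of _ ns]) (auto simp: cl comp sum_component_smult sum_component_bd_sum bd_hom)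
  qed
qed

lemma kernel_bd_sum:
  assumes ns: "length ns \<le> 3" and z: "z \<in> carrier (F_sum M r (0 # ns))"
  shows "bd_sum M r a b ns z = \<zero>\<^bsub>F_sum M r ns\<^esub> \<longleftrightarrow>
    (\<forall>j < length ns. \<forall>l < ns ! j. bd M r a b (Suc j) (sum_component r (Suc j) l z) = \<zero>\<^bsub>F_mod M r j\<^esub>)"
proof -
  interpret C: module S "F_sum M r ns" by (rule module_F_sum)
  have "bd_sum M r a b ns z = \<zero>\<^bsub>F_sum M r ns\<^esub> \<longleftrightarrow>
    (\<forall>j < length ns. \<forall>l < ns ! j. sum_component r j l (bd_sum M r a b ns z) = sum_component r j l \<zero>\<^bsub>F_sum M r ns\<^esub>)"
    using F_sum_eqI[OF bd_sum_in_carrier[OF assms] C.M.zero_closed] by auto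
  then show ?thesis by (simp add: sum_component_bd_sum[OF assms] sum_component_zero)
qed

text \<open>
  Preimages chosen for the single copies are assembled to one element of the source. A copy of
  \<open>F\<^sub>j\<close> in the target is matched with a copy of \<open>F\<^sub>j\<^sub>+\<^sub>1\<close> in the source.
\<close>

lemma image_bd_sum:
  assumes ns: "length ns \<le> 3" and z: "z \<in> carrier (F_sum M r ns)"
  shows "z \<in> bd_sum M r a b ns ` carrier (F_sum M r (0 # ns)) \<longleftrightarrow>
    (\<forall>j < length ns. \<forall>l < ns ! j. sum_component r j l z \<in> image_bd (Suc j))"
proof
  assume "z \<in> bd_sum M r a b ns ` carrier (F_sum M r (0 # ns))"
  then obtain z' where z': "z = bd_sum M r a b ns z'" "z' \<in> carrier (F_sum M r (0 # ns))" by blast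
  show "\<forall>j < length ns. \<forall>l < ns ! j. sum_component r j l z \<in> image_bd (Suc j)"
    unfolding z'(1) using sum_component_in_carrier[OF z'(2)]
    by (auto simp: sum_component_bd_sum[OF ns z'(2)])
next
  assume "\<forall>j < length ns. \<forall>l < ns ! j. sum_component r j l z \<in> image_bd (Suc j)"
  then have "\<forall>j l. \<exists>v. j < length ns \<longrightarrow> l < ns ! j \<longrightarrow>
      v \<in> carrier (F_mod M r (Suc j)) \<and> sum_component r j l z = bd M r a b (Suc j) v"
    by blast
  then obtain v where v: "\<And>j l. j < length ns \<Longrightarrow> l < ns ! j \<Longrightarrow>
      v j l \<in> carrier (F_mod M r (Suc j)) \<and> sum_component r j l z = bd M r a b (Suc j) (v j l)"
    by metis
  (* The source has no copies of F_0, so j - 1 does not truncate. *)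
  define z' where "z' = (\<lambda>(j, l, g)\<in>sum_basis r (0 # ns). v (j - 1) l g)"
  have "z' (j, l, g) \<in> carrier S" if jlg: "(j, l, g) \<in> sum_basis r (0 # ns)" for j l g
  proof -
    have "0 < j" using jlg by (cases j) (auto simp: sum_basis_iff)
    then obtain j' where j': "j = Suc j'" "j' < length ns" "l < ns ! j'" "g \<in> F_basis r (Suc j')"
      using jlg by (cases j) (auto simp: sum_basis_iff)
    then show ?thesis using v[OF j'(2,3)] jlg by (auto simp: z'_def F_mod_def free_mod_simps)
  qed
  then have z': "z' \<in> carrier (F_sum M r (0 # ns))"
    by (auto simp: F_sum_def free_mod_simps(1) PiE_iff) (simp add: z'_def)
  have comp: "sum_component r (Suc j) l z' = v j l" if "j < length ns" "l < ns ! j" for j l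
    using v[OF that] that
    by (auto simp: sum_component_def z'_def sum_basis_iff F_mod_def free_mod_simps(1)
        fun_eq_iff PiE_iff extensional_def)
  have "z = bd_sum M r a b ns z'"
    by (rule F_sum_eqI[OF z bd_sum_in_carrier[OF ns z']])
      (simp add: sum_component_bd_sum[OF ns z'] comp v)
  then show "z \<in> bd_sum M r a b ns ` carrier (F_sum M r (0 # ns))" using z' by blast
qed

lemma bd_sum_minimal:
  assumes ns: "length ns \<le> 3" and z: "z \<in> carrier (F_sum M r (0 # ns))" and t: "t \<in> sum_basis r ns"
  shows "bd_sum M r a b ns z t \<in> xy_ideal M"
proof -
  obtain j l g where t': "t = (j, l, g)" "j < length ns" "l < ns ! j" "g \<in> F_basis r j"
    using t by (cases t) (auto simp: sum_basis_iff)
  have "sum_component r (Suc j) l z \<in> carrier (F_mod M r (Suc j))"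
    using t' by (intro sum_component_in_carrier[OF z]) auto
  then have "bd M r a b (Suc j) (sum_component r (Suc j) l z) g \<in> xy_ideal M"
    using t' ns by (intro bd_minimal) auto
  then show ?thesis using z t by (simp add: bd_sum_def t'(1))
qed

section \<open>Regrouping the summands\<close>

text \<open>
  The isomorphism from \<open>F\<^sub>0\<^bsup>(r-1)w\<^esup> \<oplus> F\<^sub>1\<^bsup>u+rw\<^esup> \<oplus> F\<^sub>2\<^bsup>v\<^esup>\<close> to \<open>F\<^sub>1\<^bsup>u\<^esup> \<oplus> F\<^sub>2\<^bsup>v\<^esup> \<oplus> F\<^sub>3\<^bsup>w\<^esup>\<close> induced by the
  bijection of labels. The number \<open>w\<close> is called \<open>w'\<close> since \<open>w\<close> denotes the corner monomials.
\<close>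

definition regroup_map :: "nat \<Rightarrow> nat \<Rightarrow> nat \<Rightarrow> (label \<Rightarrow> 'k poly2 set) \<Rightarrow> label \<Rightarrow> 'k poly2 set"
  where "regroup_map u v w' z = (\<lambda>t\<in>sum_basis r [0, u, v, w']. z (regroup r u t))"

lemma regroup_in: "t \<in> sum_basis r [0, u, v, w'] \<Longrightarrow> regroup r u t \<in> sum_basis r [(r - 1) * w', u + r * w', v]"
  using bij_betw_regroup by (rule bij_betw_apply)

lemma regroup_map_in_module_homs:
  "regroup_map u v w' \<in> module_homs S (F_sum M r [(r - 1) * w', u + r * w', v]) (F_sum M r [0, u, v, w'])"
  by (auto simp: module_homs_def regroup_map_def F_sum_def free_mod_simps regroup_in
      simp del: One_nat_def intro!: restrict_ext)

lemma regroup_map_inj: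
  assumes "z \<in> carrier (F_sum M r [(r - 1) * w', u + r * w', v])"
    and "z' \<in> carrier (F_sum M r [(r - 1) * w', u + r * w', v])"
    and eq: "regroup_map u v w' z = regroup_map u v w' z'"
  shows "z = z'"
proof (rule free_mod_eqI[OF assms(1,2)[unfolded F_sum_def]])
  fix e assume "e \<in> sum_basis r [(r - 1) * w', u + r * w', v]"
  then obtain t where t: "t \<in> sum_basis r [0, u, v, w']" "e = regroup r u t"
    using bij_betw_regroup[of r u v w'] by (metis bij_betw_imp_surj_on imageE)
  from fun_cong[OF eq, of t] show "z e = z' e" using t by (simp add: regroup_map_def)
qed

lemma regroup_map_surj:
  assumes z: "z \<in> carrier (F_sum M r [0, u, v, w'])"
  obtains z0 where "z0 \<in> carrier (F_sum M r [(r - 1) * w', u + r * w', v])" "z = regroup_map u v w' z0"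
proof
  let ?f = "inv_into (sum_basis r [0, u, v, w']) (regroup r u)"
  let ?B = "sum_basis r [(r - 1) * w', u + r * w', v]"
  have f: "?f e \<in> sum_basis r [0, u, v, w']" if "e \<in> ?B" for e
    using bij_betw_inv_into[OF bij_betw_regroup] that by (rule bij_betw_apply)
  show "(\<lambda>e\<in>?B. z (?f e)) \<in> carrier (F_sum M r [(r - 1) * w', u + r * w', v])"
    using z f by (auto simp: F_sum_def free_mod_simps)
  have "?f (regroup r u t) = t" if "t \<in> sum_basis r [0, u, v, w']" for t
    using bij_betw_inv_into_left[OF bij_betw_regroup that] .
  then show "z = regroup_map u v w' (\<lambda>e\<in>?B. z (?f e))"
    using z by (auto simp: F_sum_def free_mod_simps regroup_map_def regroup_in
        fun_eq_iff PiE_iff extensional_def simp del: One_nat_def)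
qed

lemma regroup_components:
  assumes z: "z = regroup_map u v w' z0"
  shows "l < u \<Longrightarrow> sum_component r 1 l z = sum_component r 1 l z0"
    and "l < v \<Longrightarrow> sum_component r 2 l z = sum_component r 2 l z0"
    and "l < w' \<Longrightarrow> i \<in> {1..r} \<Longrightarrow>
      (\<lambda>g\<in>F_basis r 1. sum_component r 3 l z (if g = E_x then E_cx i else E_cy i)) =
        sum_component r 1 (u + (l * r + (i - 1))) z0"
    and "l < w' \<Longrightarrow> i \<in> {1..r - 1} \<Longrightarrow>
      (\<lambda>g\<in>F_basis r 0. sum_component r 3 l z (E_d i)) = sum_component r 0 (l * (r - 1) + (i - 1)) z0"
  unfolding z
  by (auto simp: sum_component_def regroup_map_def sum_basis_iff F_basis_simps regroup_def
      intro!: restrict_ext)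

text \<open>
  The heart of the recursion. The left-hand side says that \<open>z\<close> is in the kernel of the direct sum of
  copies of \<open>\<partial>\<^sub>1, \<partial>\<^sub>2, \<partial>\<^sub>3\<close>; the right-hand side says that its regrouped form is in the image of the next
  direct sum. Copies of \<open>F\<^sub>1\<close> and \<open>F\<^sub>2\<close> are matched by exactness of the blocks, and a copy of \<open>F\<^sub>3\<close> contributes
  \<open>r - 1\<close> conditions on copies of \<open>F\<^sub>0\<close> and \<open>r\<close> conditions on copies of \<open>F\<^sub>1\<close>.
\<close>

lemma sum_component_regroup_conditions:
  assumes z0: "z0 \<in> carrier (F_sum M r [(r - 1) * w', u + r * w', v])"
    and z: "z = regroup_map u v w' z0"
  shows "(\<forall>j < length [u, v, w']. \<forall>l < [u, v, w'] ! j.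
        bd M r a b (Suc j) (sum_component r (Suc j) l z) = \<zero>\<^bsub>F_mod M r j\<^esub>) \<longleftrightarrow>
    (\<forall>j < length [(r - 1) * w', u + r * w', v]. \<forall>l < [(r - 1) * w', u + r * w', v] ! j.
        sum_component r j l z0 \<in> image_bd (Suc j))"
proof -
  note comp = regroup_components[OF z]
  have zc: "z \<in> carrier (F_sum M r [0, u, v, w'])"
    using z0 regroup_map_in_module_homs[of u v w'] by (auto simp: z module_homs_def)
  have "bd M r a b 1 (sum_component r 1 l z) = \<zero>\<^bsub>F_mod M r 0\<^esub> \<longleftrightarrow> sum_component r 1 l z0 \<in> image_bd 2"
    if l: "l < u" for l
  proof -
    have "sum_component r 1 l z \<in> carrier (F_mod M r 1)"
      using l by (intro sum_component_in_carrier[OF zc]) auto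
    from kernel_bd_1[OF this] show ?thesis unfolding comp(1)[OF l] .
  qed
  moreover have "bd M r a b 2 (sum_component r 2 l z) = \<zero>\<^bsub>F_mod M r 1\<^esub> \<longleftrightarrow> sum_component r 2 l z0 \<in> image_bd 3"
    if l: "l < v" for l
  proof -
    have "sum_component r 2 l z \<in> carrier (F_mod M r 2)"
      using l by (intro sum_component_in_carrier[OF zc]) auto
    from kernel_bd_2[OF this] show ?thesis unfolding comp(2)[OF l] .
  qed
  moreover have "bd M r a b 3 (sum_component r 3 l z) = \<zero>\<^bsub>F_mod M r 2\<^esub> \<longleftrightarrow>
      (\<forall>i\<in>{1..r}. sum_component r 1 (u + (l * r + (i - 1))) z0 \<in> image_bd 2) \<and>
      (\<forall>i\<in>{1..r - 1}. sum_component r 0 (l * (r - 1) + (i - 1)) z0 \<in> image_bd 1)"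
    if l: "l < w'" for l
  proof -
    have "sum_component r 3 l z \<in> carrier (F_mod M r 3)"
      using l by (intro sum_component_in_carrier[OF zc]) auto
    then show ?thesis
      unfolding kernel_bd_3[OF \<open>sum_component r 3 l z \<in> carrier (F_mod M r 3)\<close>]
      by (intro arg_cong2[of _ _ _ _ "(\<and>)"] ball_cong refl; simp only: comp(3,4)[OF l])
  qed
  ultimately show ?thesis
    unfolding all_less_lengths_3 all_less_add_iff all_less_mult_iff
    by (auto simp: numeral_2_eq_2 numeral_3_eq_3)
qed

section \<open>The resolution\<close>

lemma res_mod_simps:
  "res_mod M r 0 = F_sum M r [1]" "res_mod M r 1 = F_sum M r [0, 1]" "res_mod M r 2 = F_sum M r [0, 0, 1]"
  "res_mult r k = (u, v, w') \<Longrightarrow> res_mod M r (k + 3) = F_sum M r [0, u, v, w']"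
  by (simp_all add: res_mod_def)

lemma res_bd_simps:
  "res_bd M r a b 1 = bd_sum M r a b [1]" "res_bd M r a b 2 = bd_sum M r a b [0, 1]"
  "res_bd M r a b 3 = bd_sum M r a b [0, 0, 1]"
  by (simp_all add: res_bd_def)

lemma res_bd_Suc:
  assumes "res_mult r k = (u, v, w')" and "z \<in> carrier (F_sum M r [0, (r - 1) * w', u + r * w', v])"
  shows "res_bd M r a b (Suc (k + 3)) z =
    regroup_map u v w' (bd_sum M r a b [(r - 1) * w', u + r * w', v] z)"
proof -
  have "res_mod M r (Suc (k + 3)) = F_sum M r [0, (r - 1) * w', u + r * w', v]"
    using res_mod_simps(4)[of "Suc k"] assms(1) by simp
  then show ?thesis
    using assms by (simp add: res_bd_def regroup_map_def del: One_nat_def)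
qed

lemma res_mod_Suc:
  "res_mult r k = (u, v, w') \<Longrightarrow> res_mod M r (Suc (k + 3)) = F_sum M r [0, (r - 1) * w', u + r * w', v]"
  using res_mod_simps(4)[of "Suc k"] by simp

lemma nat_cases_add_3: "(\<And>k. n = k + 3 \<Longrightarrow> P) \<Longrightarrow> (n = 0 \<Longrightarrow> P) \<Longrightarrow> (n = 1 \<Longrightarrow> P) \<Longrightarrow> (n = 2 \<Longrightarrow> P) \<Longrightarrow> P" for n :: nat
proof -
  assume *: "\<And>k. n = k + 3 \<Longrightarrow> P" "n = 0 \<Longrightarrow> P" "n = 1 \<Longrightarrow> P" "n = 2 \<Longrightarrow> P"
  show P
  proof (cases "n < 3")
    case True
    then have "n = 0 \<or> n = 1 \<or> n = 2" by auto
    then show P using * by blast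
  next
    case False
    then show P by (intro *(1)[of "n - 3"]) simp
  qed
qed

lemma res_mod_free_mod: "\<exists>ns. res_mod M r i = F_sum M r ns"
proof (rule nat_cases_add_3[of i])
  fix k assume "i = k + 3"
  then show ?thesis by (metis res_mod_simps(4) prod_cases3)
qed (auto simp: res_mod_def)

lemma res_bd_regrouped_in_module_homs:
  "res_bd M r a b (Suc (k + 3)) \<in> module_homs S (res_mod M r (Suc (k + 3))) (res_mod M r (k + 3))"
proof -
  obtain u v w' where uvw: "res_mult r k = (u, v, w')" by (rule prod_cases3)
  let ?ns = "[(r - 1) * w', u + r * w', v]"
  have "bd_sum M r a b ?ns \<in> module_homs S (F_sum M r (0 # ?ns)) (F_sum M r ?ns)"
    by (rule bd_sum_in_module_homs) simp
  then show ?thesis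
    unfolding res_mod_Suc[OF uvw] res_mod_simps(4)[OF uvw]
    by (rule module_homs_compI[OF module_F_sum _ regroup_map_in_module_homs]) (rule res_bd_Suc[OF uvw])
qed

lemma res_bd_in_module_homs:
  "res_bd M r a b (Suc i) \<in> module_homs S (res_mod M r (Suc i)) (res_mod M r i)"
proof (rule nat_cases_add_3[of i])
  fix k assume "i = k + 3"
  then show ?thesis using res_bd_regrouped_in_module_homs[of k] by simp
next
  assume "i = 0"
  then show ?thesis using bd_sum_in_module_homs[of "[1]"] by (simp add: res_bd_def res_mod_def)
next
  assume "i = 1"
  then show ?thesis using bd_sum_in_module_homs[of "[0, 1]"]
    by (simp add: res_bd_def res_mod_def)
next
  assume "i = 2"
  then show ?thesis using bd_sum_in_module_homs[of "[0, 0, 1]"]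
    by (simp add: res_bd_def res_mod_def)
qed

text \<open>
  From degree 4 on, the differential is the direct sum followed by the injective regrouping; in degree 3 it
  is the map \<open>\<partial>\<^sub>3\<close> itself. In both cases the kernel is that of the direct sum.
\<close>

lemma kernel_res_bd:
  assumes k: "res_mult r k = (u, v, w')" and z: "z \<in> carrier (F_sum M r [0, u, v, w'])"
  shows "res_bd M r a b (k + 3) z = \<zero>\<^bsub>res_mod M r (k + 2)\<^esub> \<longleftrightarrow>
    bd_sum M r a b [u, v, w'] z = \<zero>\<^bsub>F_sum M r [u, v, w']\<^esub>"
proof (cases k)
  case 0
  then show ?thesis using k by (auto simp: res_bd_def res_mod_def)
next
  case (Suc k')
  obtain u' v' w'' where uvw: "res_mult r k' = (u', v', w'')" by (rule prod_cases3)
  have eq: "u = (r - 1) * w''" "v = u' + r * w''" "w' = v'" using k uvw Suc by auto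
  interpret C: module S "F_sum M r [u, v, w']" by (rule module_F_sum)
  have zero: "regroup_map u' v' w'' \<zero>\<^bsub>F_sum M r [u, v, w']\<^esub> = \<zero>\<^bsub>F_sum M r [0, u', v', w'']\<^esub>"
    unfolding eq by (auto simp: regroup_map_def F_sum_def free_mod_simps regroup_in simp del: One_nat_def intro!: restrict_ext)
  have "res_bd M r a b (Suc (k' + 3)) z = regroup_map u' v' w'' (bd_sum M r a b [u, v, w'] z)"
    using res_bd_Suc[OF uvw, of z] z by (simp add: eq)
  moreover have "res_mod M r (k + 2) = F_sum M r [0, u', v', w'']"
    using res_mod_simps(4)[OF uvw] by (simp add: Suc numeral_2_eq_2 numeral_3_eq_3)
  ultimately have "res_bd M r a b (k + 3) z = \<zero>\<^bsub>res_mod M r (k + 2)\<^esub> \<longleftrightarrow>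
      regroup_map u' v' w'' (bd_sum M r a b [u, v, w'] z) = regroup_map u' v' w'' \<zero>\<^bsub>F_sum M r [u, v, w']\<^esub>"
    using Suc zero by simp
  also have "\<dots> \<longleftrightarrow> bd_sum M r a b [u, v, w'] z = \<zero>\<^bsub>F_sum M r [u, v, w']\<^esub>"
    using regroup_map_inj[of "bd_sum M r a b [u, v, w'] z" w'' u' v' "\<zero>\<^bsub>F_sum M r [u, v, w']\<^esub>"]
      bd_sum_in_carrier[of "[u, v, w']" z] C.M.zero_closed z
    by (auto simp: eq simp del: One_nat_def)
  finally show ?thesis .
qed

lemma exact_from_3:
  "a_kernel (res_mod M r (k + 3)) (res_mod M r (k + 2)) (res_bd M r a b (k + 3)) =
    res_bd M r a b (Suc (k + 3)) ` carrier (res_mod M r (Suc (k + 3)))"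
proof -
  obtain u v w' where uvw: "res_mult r k = (u, v, w')" by (rule prod_cases3)
  let ?ns = "[(r - 1) * w', u + r * w', v]"
  have image: "res_bd M r a b (Suc (k + 3)) ` carrier (res_mod M r (Suc (k + 3)))
      = regroup_map u v w' ` bd_sum M r a b ?ns ` carrier (F_sum M r (0 # ?ns))"
    unfolding res_mod_Suc[OF uvw] image_image
    by (rule image_cong[OF refl]) (rule res_bd_Suc[OF uvw])
  have sub: "bd_sum M r a b ?ns ` carrier (F_sum M r (0 # ?ns)) \<subseteq> carrier (F_sum M r ?ns)"
    using bd_sum_in_carrier[of ?ns] by (auto simp del: One_nat_def)
  have "res_bd M r a b (k + 3) z = \<zero>\<^bsub>res_mod M r (k + 2)\<^esub> \<longleftrightarrow>
      z \<in> regroup_map u v w' ` bd_sum M r a b ?ns ` carrier (F_sum M r (0 # ?ns))"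
    if z: "z \<in> carrier (F_sum M r [0, u, v, w'])" for z
  proof -
    obtain z0 where z0: "z0 \<in> carrier (F_sum M r ?ns)" "z = regroup_map u v w' z0"
      using z by (rule regroup_map_surj)
    have "res_bd M r a b (k + 3) z = \<zero>\<^bsub>res_mod M r (k + 2)\<^esub> \<longleftrightarrow>
        (\<forall>j < length [u, v, w']. \<forall>l < [u, v, w'] ! j.
          bd M r a b (Suc j) (sum_component r (Suc j) l z) = \<zero>\<^bsub>F_mod M r j\<^esub>)"
      unfolding kernel_res_bd[OF uvw z] by (rule kernel_bd_sum) (use z in auto)
    also have "\<dots> \<longleftrightarrow> z0 \<in> bd_sum M r a b ?ns ` carrier (F_sum M r (0 # ?ns))"
      unfolding sum_component_regroup_conditions[OF z0] by (rule image_bd_sum[symmetric]) (use z0 in auto)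
    also have "\<dots> \<longleftrightarrow> z \<in> regroup_map u v w' ` bd_sum M r a b ?ns ` carrier (F_sum M r (0 # ?ns))"
      unfolding z0(2) using regroup_map_inj[OF z0(1)] sub by blast
    finally show ?thesis .
  qed
  moreover have "regroup_map u v w' ` bd_sum M r a b ?ns ` carrier (F_sum M r (0 # ?ns))
      \<subseteq> carrier (F_sum M r [0, u, v, w'])"
    using sub regroup_map_in_module_homs[of u v w'] unfolding module_homs_def by blast
  ultimately show ?thesis
    unfolding image unfolding a_kernel_def' res_mod_simps(4)[OF uvw] by blast
qed

lemma exact_at_1_2:
  "a_kernel (res_mod M r 1) (res_mod M r 0) (res_bd M r a b 1) = res_bd M r a b 2 ` carrier (res_mod M r 2)"
  "a_kernel (res_mod M r 2) (res_mod M r 1) (res_bd M r a b 2) = res_bd M r a b 3 ` carrier (res_mod M r 3)"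
proof -
  have "bd_sum M r a b [1] z = \<zero>\<^bsub>F_sum M r [1]\<^esub> \<longleftrightarrow> z \<in> bd_sum M r a b [0, 1] ` carrier (F_sum M r [0, 0, 1])"
    if z: "z \<in> carrier (F_sum M r [0, 1])" for z
    using kernel_bd_sum[of "[1]" z] image_bd_sum[of "[0, 1]" z] z
      kernel_bd_1[OF sum_component_in_carrier[OF z, of 1 0]]
    by (auto simp: All_less_Suc numeral_2_eq_2)
  moreover have "bd_sum M r a b [0, 1] ` carrier (F_sum M r [0, 0, 1]) \<subseteq> carrier (F_sum M r [0, 1])"
    using bd_sum_in_carrier[of "[0, 1]"] by auto
  ultimately show "a_kernel (res_mod M r 1) (res_mod M r 0) (res_bd M r a b 1) = res_bd M r a b 2 ` carrier (res_mod M r 2)"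
    unfolding a_kernel_def' res_mod_simps res_bd_simps by blast
  have "bd_sum M r a b [0, 1] z = \<zero>\<^bsub>F_sum M r [0, 1]\<^esub> \<longleftrightarrow> z \<in> bd_sum M r a b [0, 0, 1] ` carrier (F_sum M r [0, 0, 0, 1])"
    if z: "z \<in> carrier (F_sum M r [0, 0, 1])" for z
    using kernel_bd_sum[of "[0, 1]" z] image_bd_sum[of "[0, 0, 1]" z] z
      kernel_bd_2[OF sum_component_in_carrier[OF z, of 2 0]]
    by (auto simp: All_less_Suc numeral_2_eq_2 numeral_3_eq_3)
  moreover have "bd_sum M r a b [0, 0, 1] ` carrier (F_sum M r [0, 0, 0, 1]) \<subseteq> carrier (F_sum M r [0, 0, 1])"
    using bd_sum_in_carrier[of "[0, 0, 1]"] by auto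
  moreover have res3: "res_mod M r 3 = F_sum M r [0, 0, 0, 1]" using res_mod_simps(4)[of 0] by simp
  ultimately show "a_kernel (res_mod M r 2) (res_mod M r 1) (res_bd M r a b 2) = res_bd M r a b 3 ` carrier (res_mod M r 3)"
    unfolding a_kernel_def' res_mod_simps(1-3) res_bd_simps res3 by blast
qed

lemma exact_at_Suc:
  "a_kernel (res_mod M r (Suc i)) (res_mod M r i) (res_bd M r a b (Suc i)) =
    res_bd M r a b (Suc (Suc i)) ` carrier (res_mod M r (Suc (Suc i)))"
proof -
  consider "i = 0" | "i = 1" | k where "i = k + 2"
    by (cases i; cases "i - 1") auto
  then show ?thesis
  proof cases
    case (3 k)
    then show ?thesis using exact_from_3[of k] by (simp add: numeral_2_eq_2 numeral_3_eq_3)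
  qed (use exact_at_1_2 in \<open>simp_all add: numeral_2_eq_2 numeral_3_eq_3\<close>)
qed

text \<open>
  Regrouping only permutes the entries, so it suffices that all entries are in the ideal before regrouping.
\<close>

lemma res_bd_minimal:
  "res_bd M r a b (Suc i) ` carrier (res_mod M r (Suc i)) \<subseteq> ideal_smult S (xy_ideal M) (res_mod M r i)"
proof -
  have minI: "z \<in> ideal_smult S (xy_ideal M) (F_sum M r ns)"
    if "z \<in> carrier (F_sum M r ns)" "\<And>t. t \<in> sum_basis r ns \<Longrightarrow> z t \<in> xy_ideal M" for z ns
    using in_ideal_smult_free_modI[OF cring_S ideal_xy finite_sum_basis] that unfolding F_sum_def by blast
  have bd_sum: "bd_sum M r a b ns ` carrier (F_sum M r (0 # ns)) \<subseteq> ideal_smult S (xy_ideal M) (F_sum M r ns)"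
    if "length ns \<le> 3" for ns
    using bd_sum_in_carrier[OF that] bd_sum_minimal[OF that] by (auto intro!: minI)
  show ?thesis
  proof (rule nat_cases_add_3[of i])
    fix k assume i: "i = k + 3"
    obtain u v w' where uvw: "res_mult r k = (u, v, w')" by (rule prod_cases3)
    let ?ns = "[(r - 1) * w', u + r * w', v]"
    have "regroup_map u v w' (bd_sum M r a b ?ns z) \<in> ideal_smult S (xy_ideal M) (F_sum M r [0, u, v, w'])"
      if z: "z \<in> carrier (F_sum M r (0 # ?ns))" for z
    proof (rule minI)
      have "bd_sum M r a b ?ns z \<in> carrier (F_sum M r ?ns)" by (rule bd_sum_in_carrier[OF _ z]) simp
      then show "regroup_map u v w' (bd_sum M r a b ?ns z) \<in> carrier (F_sum M r [0, u, v, w'])"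
        using regroup_map_in_module_homs[of u v w'] unfolding module_homs_def by blast
      fix t assume t: "t \<in> sum_basis r [0, u, v, w']"
      then show "regroup_map u v w' (bd_sum M r a b ?ns z) t \<in> xy_ideal M"
        using bd_sum_minimal[OF _ z regroup_in[OF t]] by (simp add: regroup_map_def)
    qed
    then show ?thesis
      unfolding i res_mod_Suc[OF uvw] res_mod_simps(4)[OF uvw] using res_bd_Suc[OF uvw] by auto
  next
    assume "i = 0"
    then show ?thesis using bd_sum[of "[1]"] by (simp add: res_bd_def res_mod_def)
  next
    assume "i = 1"
    then show ?thesis using bd_sum[of "[0, 1]"] by (simp add: res_bd_def res_mod_def)
  next
    assume "i = 2"
    then show ?thesis using bd_sum[of "[0, 0, 1]"] by (simp add: res_bd_def res_mod_def)
  qed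
qed

text \<open>
  The kernel of the augmentation consists of the elements whose only coordinate is in \<open>(x, y) S\<close>, and this
  is the image of \<open>\<partial>\<^sub>1\<close>.
\<close>

lemma augmentation_exact:
  "augmentation M \<in> module_homs S (res_mod M r 0) (residue_field M)"
  "augmentation M ` carrier (res_mod M r 0) = carrier (residue_field M)"
  "a_kernel (res_mod M r 0) (residue_field M) (augmentation M) = res_bd M r a b 1 ` carrier (res_mod M r 1)"
proof -
  interpret S: cring S by (rule cring_S)
  interpret I: ideal "xy_ideal M" S by (rule ideal_xy)
  note hom = I.rcos_ring_hom
  have F0: "sum_basis r [1] = {(0, 0, E_1)}" "sum_basis r [Suc 0] = {(0, 0, E_1)}"
    by (auto simp: sum_basis_def F_basis_simps)
  have carr: "carrier (residue_field M) = (\<lambda>s. xy_ideal M +>\<^bsub>S\<^esub> s) ` carrier S"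
    by (auto simp: residue_field_def quotient_module_def FactRing_def A_RCOSETS_defs a_r_coset_def)
  show "augmentation M \<in> module_homs S (res_mod M r 0) (residue_field M)"
    unfolding module_homs_def
  proof (intro CollectI conjI ballI)
    show "augmentation M \<in> carrier (res_mod M r 0) \<rightarrow> carrier (residue_field M)"
      by (auto simp: carr augmentation_def res_mod_simps F_sum_def free_mod_simps F0)
    fix u assume u: "u \<in> carrier (res_mod M r 0)"
    then have s: "u (0, 0, E_1) \<in> carrier S"
      by (auto simp: res_mod_simps F_sum_def free_mod_simps F0)
    {
      fix v assume "v \<in> carrier (res_mod M r 0)"
      then have "v (0, 0, E_1) \<in> carrier S"
        by (auto simp: res_mod_simps F_sum_def free_mod_simps F0)
      from ring_hom_add[OF hom s this]
      show "augmentation M (u \<oplus>\<^bsub>res_mod M r 0\<^esub> v) = augmentation M u \<oplus>\<^bsub>residue_field M\<^esub> augmentation M v"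
        by (simp add: augmentation_def residue_field_def quotient_module_def
            res_mod_simps(1) F_sum_def free_mod_simps(3) F0)
    next
      fix c assume "c \<in> carrier S"
      from ring_hom_mult[OF hom this s]
      show "augmentation M (c \<odot>\<^bsub>res_mod M r 0\<^esub> u) = c \<odot>\<^bsub>residue_field M\<^esub> augmentation M u"
        by (simp add: augmentation_def residue_field_def quotient_module_def
            res_mod_simps(1) F_sum_def free_mod_simps(4) F0)
    }
  qed
  show "augmentation M ` carrier (res_mod M r 0) = carrier (residue_field M)"
  proof -
    have "xy_ideal M +>\<^bsub>S\<^esub> s = augmentation M (\<lambda>e\<in>sum_basis r [1]. s)" for s
      by (simp add: augmentation_def F0)
    moreover have "(\<lambda>e\<in>sum_basis r [1]. s) \<in> carrier (res_mod M r 0)" if "s \<in> carrier S" for s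
      using that by (simp add: res_mod_simps F_sum_def free_mod_simps)
    ultimately have "carrier (residue_field M) \<subseteq> augmentation M ` carrier (res_mod M r 0)"
      unfolding carr by blast
    moreover have "augmentation M ` carrier (res_mod M r 0) \<subseteq> carrier (residue_field M)"
      by (auto simp: carr augmentation_def res_mod_simps F_sum_def free_mod_simps F0)
    ultimately show ?thesis by blast
  qed
  have "augmentation M z = \<zero>\<^bsub>residue_field M\<^esub> \<longleftrightarrow> z \<in> bd_sum M r a b [1] ` carrier (F_sum M r [0, 1])"
    if z: "z \<in> carrier (F_sum M r [1])" for z
  proof -
    have s: "z (0, 0, E_1) \<in> carrier S" using z by (auto simp: F_sum_def free_mod_simps F0)
    have "augmentation M z = \<zero>\<^bsub>residue_field M\<^esub> \<longleftrightarrow> xy_ideal M +>\<^bsub>S\<^esub> z (0, 0, E_1) = xy_ideal M"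
      by (simp add: augmentation_def residue_field_def quotient_module_def FactRing_def)
    also have "\<dots> \<longleftrightarrow> z (0, 0, E_1) \<in> xy_ideal M"
      using S.a_rcos_zero[OF ideal_xy] I.rcos_const_imp_mem[OF s] by blast
    also have "\<dots> \<longleftrightarrow> sum_component r 0 0 z \<in> image_bd 1"
      using image_bd_1[OF sum_component_in_carrier[OF z, of 0 0]]
      by (simp add: sum_component_def F_basis_simps)
    also have "\<dots> \<longleftrightarrow> z \<in> bd_sum M r a b [1] ` carrier (F_sum M r [0, 1])"
      using image_bd_sum[of "[1]" z] z by simp
    finally show ?thesis .
  qed
  moreover have "bd_sum M r a b [1] ` carrier (F_sum M r [0, 1]) \<subseteq> carrier (F_sum M r [1])"
    using bd_sum_in_carrier[of "[1]"] by auto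
  ultimately show "a_kernel (res_mod M r 0) (residue_field M) (augmentation M) =
      res_bd M r a b 1 ` carrier (res_mod M r 1)"
    unfolding a_kernel_def' res_mod_simps res_bd_simps by blast
qed

lemma staircase_minimal_free_resolution:
  "minimal_free_resolution S (xy_ideal M) (res_mod M r) (res_bd M r a b) (residue_field M) (augmentation M)"
proof -
  have "finite_free_module S (res_mod M r i)" for i
  proof -
    obtain ns where "res_mod M r i = F_sum M r ns" using res_mod_free_mod by blast
    then show ?thesis
      unfolding F_sum_def
      using finite_free_module_free_mod[OF cring_S finite_sum_basis one_not_zero_S] by simp
  qed
  then show ?thesis
    unfolding minimal_free_resolution_def free_resolution_def
    using cring_S module_quotient_module[OF cring_S ideal_xy] augmentation_exact
      res_bd_in_module_homs exact_at_Suc res_bd_minimal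
    by (simp add: residue_field_def)
qed

end

theorem theorem5p1:
  fixes M :: "(nat \<times> nat \<Rightarrow>\<^sub>0 'k::field) set"
    and r :: nat
    and a b :: "nat \<Rightarrow> nat"
  assumes min_gens: "minimal_generating_set kxy M ((\<lambda>i. mono2 (a i) (b i)) ` {1..r})"
    and a_decreasing: "\<And>i j. 1 \<le> i \<Longrightarrow> i < j \<Longrightarrow> j \<le> r \<Longrightarrow> a j < a i"
    and b_increasing: "\<And>i j. 1 \<le> i \<Longrightarrow> i < j \<Longrightarrow> j \<le> r \<Longrightarrow> b i < b j"
    and r: "r > 2 \<or> r = 2 \<and> \<not> generated_by_pure_powers M"
  shows "minimal_free_resolution (quot_ring M) (xy_ideal M)
           (res_mod M r) (res_bd M r a b) (residue_field M) (augmentation M)"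
proof -
  have M: "M = Idl\<^bsub>kxy\<^esub> ((\<lambda>i. mono2 (a i) (b i)) ` {1..r})"
    using min_gens by (simp add: minimal_generating_set_def)
  have "\<not> (r = 2 \<and> a 2 = 0 \<and> b 1 = 0)"
  proof
    assume pure: "r = 2 \<and> a 2 = 0 \<and> b 1 = 0"
    have "{1..r} = {1, 2}" using pure by auto
    then have "(\<lambda>i. mono2 (a i) (b i)) ` {1..r} \<subseteq> range (\<lambda>n. mono2 n 0) \<union> range (\<lambda>n. mono2 0 n)"
      using pure by auto
    then have "generated_by_pure_powers M" unfolding generated_by_pure_powers_def M by blast
    then show False using r pure by simp
  qed
  then interpret staircase M r a b
    using M a_decreasing b_increasing r by unfold_locales auto
  show ?thesis by (rule staircase_minimal_free_resolution)
qed

end
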